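(* For the first-order linear differential equation $$a_0y(t)+a_1y'(t)=b_0x(t)$$ with real constants $a_0,a_1,b_0$ ($a_1\neq0$) and causal excitation function $x(t)=u(t)x(t)$, the total solution is $$y(t)=y_{\rm e}(t)+y_{\rm s}(t)=u(t)\beta e^{-\alpha t}\int_0^tx(\tau)e^{\alpha\tau}\,d\tau+y_{\rm s}(0)e^{-\alpha t};\qquad \alpha=a_0/a_1,\quad\beta=b_0/a_1.$$ The first term is the evoked solution $y_{\rm e}(t)$. The second term is the spontaneous solution $y_{\rm s}(t)=y_{\rm s}(0)e^{-\alpha t}$ for $-\infty<t$, where $y_{\rm s}(0)$ is an arbitrary real constant (the initial value at $t=0$ of the spontaneous solution itself).
   Context: $x(t)$ is the excitation function and $y(t)$ the response function. The spontaneous solution $y_{\rm s}(t)$ is the general solution of the homogeneous equation $a_0y_{\rm s}(t)+a_1y_{\rm s}'(t)=0$. The evoked solution $y_{\rm e}(t)$ is the part of the total response elicited by the excitation function alone, i.e. the total (general) solution minus the general solution of the homogeneous equation; it is causal. The unit step function is $u(t)=\int_{-\infty}^t\delta(\tau)\,d\tau$. Explicitly, $u(t)=0$ for $t<0$, $u(t)=u_0(t)$ at $t=0$, and $u(t)=1$ for $t>0$. Here $u_0(t)$, the unit connect function, is a pseudo-function existing at $t=0$ and conceived of as the infinite set $\{0\ldots1\}$ of real numbers that fills the transition from $u(-0)=0$ to $u(+0)=1$. Its non-ordinary derivatives are the impulse functions $u_0^{(n)}(t)=u^{(n)}(t)=\delta^{(n-1)}(t)$, $n=1,2,\ldots$.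 A function is causal if it is null for $t<0$ and is unchanged by multiplication by $u(t)$. Impulse functions are causal, since $u(t)\delta^{(n)}(t)=\delta^{(n)}(t)$ for $n=0,1,\ldots$. For a real function $g$, the integral from $0$ is understood through $u(t)\int_0^tg(\tau)\,d\tau=\int_{-\infty}^tu(\tau)g(\tau)\,d\tau$. Derivatives of causal functions are in general non-ordinary and are treated informally. *)

theory Defs
  imports "HOL-Analysis.Analysis"
begin

text \<open>
  Excitations and responses may be ordinary functions or impulse functions
  \<open>\<delta>\<^sup>(\<^sup>n\<^sup>)\<close>, and derivatives are non-ordinary.  Both are made precise by
  (Schwartz) distributions on the real line, with values in the reals.  A distribution is
  represented by a functional on \<^emph>\<open>all\<close> functions, of which only the values on test
  functions matter; accordingly distributions are compared by \<open>=\<^sub>D\<close>.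
\<close>

definition smooth :: "(real \<Rightarrow> real) \<Rightarrow> bool" where
  "smooth f \<longleftrightarrow> (\<forall>k t. (deriv ^^ k) f differentiable (at t))"

definition test_function :: "(real \<Rightarrow> real) \<Rightarrow> bool" where
  "test_function \<phi> \<longleftrightarrow> smooth \<phi> \<and> bounded {t. \<phi> t \<noteq> 0}"

type_synonym functional = "(real \<Rightarrow> real) \<Rightarrow> real"

definition is_distribution :: "functional \<Rightarrow> bool" where
  "is_distribution T \<longleftrightarrow>
     (\<forall>\<phi> \<psi>. test_function \<phi> \<longrightarrow> test_function \<psi> \<longrightarrow>
        T (\<lambda>t. \<phi> t + \<psi> t) = T \<phi> + T \<psi>) \<and>
     (\<forall>c \<phi>. test_function \<phi> \<longrightarrow> T (\<lambda>t. c * \<phi> t) = c * T \<phi>) \<and>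
     (\<forall>R. \<exists>C N. \<forall>\<phi>. test_function \<phi> \<longrightarrow> {t. \<phi> t \<noteq> 0} \<subseteq> {-R..R} \<longrightarrow>
        \<bar>T \<phi>\<bar> \<le> C * (\<Sum>k\<le>N. SUP t. \<bar>(deriv ^^ k) \<phi> t\<bar>))"

definition dist_eq :: "functional \<Rightarrow> functional \<Rightarrow> bool" (infix "=\<^sub>D" 50) where
  "S =\<^sub>D T \<longleftrightarrow> (\<forall>\<phi>. test_function \<phi> \<longrightarrow> S \<phi> = T \<phi>)"

definition dist_add :: "functional \<Rightarrow> functional \<Rightarrow> functional" (infixl "+\<^sub>D" 65) where
  "S +\<^sub>D T = (\<lambda>\<phi>. S \<phi> + T \<phi>)"

definition fun_mult :: "(real \<Rightarrow> real) \<Rightarrow> functional \<Rightarrow> functional" (infixr "*\<^sub>D" 70) where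
  "g *\<^sub>D T = (\<lambda>\<phi>. T (\<lambda>t. g t * \<phi> t))"

definition dist_deriv :: "functional \<Rightarrow> functional" where
  "dist_deriv T = (\<lambda>\<phi>. - T (deriv \<phi>))"

definition locally_integrable :: "(real \<Rightarrow> real) \<Rightarrow> bool" where
  "locally_integrable f \<longleftrightarrow> (\<forall>a b. f absolutely_integrable_on {a..b})"

definition regular :: "(real \<Rightarrow> real) \<Rightarrow> functional" where
  "regular f = (\<lambda>\<phi>. integral UNIV (\<lambda>t. f t * \<phi> t))"


text \<open>
  The transition set \<open>{0\<dots>1}\<close> at \<open>t = 0\<close> carries no mass, so a distribution does not
  see which value the step takes there.  With the value \<open>1\<close> the equation
  \<open>u f = f\<close> restricts \<open>f\<close> on \<open>t < 0\<close> only.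
\<close>

definition unit_step :: "real \<Rightarrow> real" where
  "unit_step t = (if t < 0 then 0 else 1)"

definition causal_fun :: "(real \<Rightarrow> real) \<Rightarrow> bool" where
  "causal_fun f \<longleftrightarrow> (\<forall>t. unit_step t * f t = f t)"

text \<open>
  For distributions, being causal means having support in \<open>[0,\<infinity>)\<close>; this
  includes \<open>\<delta>\<close> and all its derivatives.
\<close>

definition causal :: "functional \<Rightarrow> bool" where
  "causal T \<longleftrightarrow>
     (\<forall>\<phi>. test_function \<phi> \<longrightarrow> closure {t. \<phi> t \<noteq> 0} \<subseteq> {..<0} \<longrightarrow> T \<phi> = 0)"

text \<open>
  The running integral \<open>\<integral>\<^sub>-\<^sub>\<infinity>\<^sup>t T(\<tau>) d\<tau>\<close> of a causal distribution, which is the meaning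
  of \<open>u(t) \<integral>\<^sub>0\<^sup>t T(\<tau>) d\<tau>\<close>.  Tested against \<open>\<phi>\<close> and with the order of integration exchanged,
  it is \<open>T\<close> applied to \<open>s \<mapsto> \<integral>\<^sub>s\<^sup>\<infinity> \<phi>\<close>.  This function need not vanish for large negative
  \<open>s\<close>, so it is replaced by a test function that agrees with it on a neighbourhood of
  \<open>[0,\<infinity>)\<close>; for causal \<open>T\<close> the choice is immaterial.
\<close>

definition integral_from_0 :: "functional \<Rightarrow> functional" where
  "integral_from_0 T = (\<lambda>\<phi>.
     T (SOME \<psi>. test_function \<psi> \<and>
          (\<exists>\<epsilon>>0. \<forall>s>-\<epsilon>. \<psi> s = integral {s..} \<phi>)))"


definition total_solution ::
    "real \<Rightarrow> real \<Rightarrow> real \<Rightarrow> functional \<Rightarrow> functional \<Rightarrow> bool" where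
  "total_solution a\<^sub>0 a\<^sub>1 b\<^sub>0 x y \<longleftrightarrow> is_distribution y \<and>
     (\<lambda>_. a\<^sub>0) *\<^sub>D y +\<^sub>D (\<lambda>_. a\<^sub>1) *\<^sub>D dist_deriv y =\<^sub>D (\<lambda>_. b\<^sub>0) *\<^sub>D x"

definition spontaneous_solution :: "real \<Rightarrow> real \<Rightarrow> functional \<Rightarrow> bool" where
  "spontaneous_solution a\<^sub>0 a\<^sub>1 y\<^sub>s \<longleftrightarrow> is_distribution y\<^sub>s \<and>
     (\<lambda>_. a\<^sub>0) *\<^sub>D y\<^sub>s +\<^sub>D (\<lambda>_. a\<^sub>1) *\<^sub>D dist_deriv y\<^sub>s =\<^sub>D (\<lambda>_. 0)"

text \<open>The causal part that remains of the general solution once the general solution of the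
  homogeneous equation is taken away.\<close>

definition evoked_solution ::
    "real \<Rightarrow> real \<Rightarrow> real \<Rightarrow> functional \<Rightarrow> functional \<Rightarrow> bool" where
  "evoked_solution a\<^sub>0 a\<^sub>1 b\<^sub>0 x y\<^sub>e \<longleftrightarrow> is_distribution y\<^sub>e \<and> causal y\<^sub>e \<and>
     (\<forall>y. total_solution a\<^sub>0 a\<^sub>1 b\<^sub>0 x y \<longleftrightarrow>
        (\<exists>y\<^sub>s. spontaneous_solution a\<^sub>0 a\<^sub>1 y\<^sub>s \<and> y =\<^sub>D y\<^sub>e +\<^sub>D y\<^sub>s))"

end

theory Submission
  imports Defs
begin

text \<open>
  The theorem is the method of variation of constants, carried out for distributions.

  Tested against \<open>\<phi>\<close>, the equation reads \<open>a\<^sub>0 y(\<phi>) - a\<^sub>1 y(\<phi>') = b\<^sub>0 x(\<phi>)\<close>.  For a causal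
  distribution \<open>T\<close> the running integral is again a causal distribution, and its derivative is \<open>T\<close>
  (\<open>is_distribution_integral_from_0\<close>, \<open>causal_integral_from_0\<close>, \<open>integral_from_0_deriv\<close>).  With
  \<open>T = exp (\<alpha> \<tau>) x\<close>, the product rule \<open>exp_mult_dist_deriv\<close> shows that \<open>y\<^sub>e\<close> is a causal solution
  (\<open>causal_solution\<close>).  The integrating factor \<open>exp (\<alpha> t)\<close> reduces the homogeneous equation to
  \<open>z' = 0\<close>, and a distribution with zero derivative is a constant
  (\<open>zero_derivative_imp_constant\<close>); so the spontaneous solutions are exactly the functions
  \<open>c exp (- \<alpha> t)\<close> (\<open>spontaneous_solution_iff\<close>).  By linearity the total solutions are \<open>y\<^sub>e\<close> plus
  these.  Another evoked solution differs from \<open>y\<^sub>e\<close> by a causal spontaneous one, and \<open>c exp (- \<alpha> t)\<close>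
  is causal only for \<open>c = 0\<close>, which makes the evoked solution unique.

  Two analytic points need care.  The running integral is defined by means of an arbitrary test
  function that agrees with \<open>\<integral>\<^sub>s\<^sup>\<infinity> \<phi>\<close> near \<open>[0, \<infinity>)\<close>.  Such a function must be shown to exist, and
  its derivatives must be bounded by those of \<open>\<phi>\<close>; both come from an explicit smooth cutoff, built
  from \<open>exp (- 1 / t)\<close>.  For an ordinary excitation, identifying the distributional running integral
  with the ordinary one is an integration by parts in which one factor is only the indefinite
  integral of an integrable function (\<open>integration_by_parts_indefinite\<close>).
\<close>

section \<open>Smooth functions\<close>

lemma smooth_coinduct:
  assumes "P f"
    and step: "\<And>f. P f \<Longrightarrow> (\<forall>t. f differentiable (at t)) \<and> P (deriv f)"
  shows "smooth f"
proof -
  have "P ((deriv ^^ k) f)" for k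
    using assms(1) by (induction k) (auto dest: step)
  then show ?thesis
    using step unfolding smooth_def by blast
qed

lemma smooth_differentiable: "smooth f \<Longrightarrow> f differentiable (at t)"
  unfolding smooth_def by (metis funpow_0)

lemma smooth_funpow_deriv: "smooth f \<Longrightarrow> smooth ((deriv ^^ k) f)"
  unfolding smooth_def by (metis comp_apply funpow_add)

lemma smooth_deriv: "smooth f \<Longrightarrow> smooth (deriv f)"
  using smooth_funpow_deriv[of f 1] by simp

lemma smooth_DERIV: "smooth f \<Longrightarrow> (f has_real_derivative deriv f t) (at t)"
  by (simp add: DERIV_deriv_iff_real_differentiable smooth_differentiable)

lemma smooth_continuous_on: "smooth f \<Longrightarrow> continuous_on A f"
  by (meson DERIV_isCont continuous_at_imp_continuous_on smooth_DERIV)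

lemma smoothI_DERIV:
  assumes "\<And>t. (f has_real_derivative g t) (at t)" "smooth g"
  shows "smooth f"
proof -
  have "deriv f = g"
    using assms(1) by (auto intro: DERIV_imp_deriv)
  then show ?thesis
    using assms smooth_differentiable real_differentiable_def
    by (intro smooth_coinduct[of "\<lambda>h. h = f \<or> smooth h"]) (blast intro: smooth_deriv)+
qed

lemma smooth_const: "smooth (\<lambda>t. c)"
  by (rule smooth_coinduct[of "\<lambda>h. \<exists>c. h = (\<lambda>t. c)"]) auto

text \<open>
  The derivative of a product is a sum of two products, so products alone are not closed under
  differentiation; finite sums of products are.\<close>
inductive sum_of_products :: "(real \<Rightarrow> real) \<Rightarrow> bool" where
  prod: "smooth f \<Longrightarrow> smooth g \<Longrightarrow> sum_of_products (\<lambda>t. f t * g t)"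
| sum: "sum_of_products f \<Longrightarrow> sum_of_products g \<Longrightarrow> sum_of_products (\<lambda>t. f t + g t)"

lemma deriv_mult_smooth:
  "smooth f \<Longrightarrow> smooth g \<Longrightarrow> deriv (\<lambda>t. f t * g t) = (\<lambda>t. deriv f t * g t + f t * deriv g t)"
  by (rule ext, rule DERIV_imp_deriv) (auto intro!: derivative_eq_intros smooth_DERIV)

lemma sum_of_products_smooth: "sum_of_products f \<Longrightarrow> smooth f"
proof (rule smooth_coinduct[of sum_of_products])
  fix f assume "sum_of_products f"
  then show "(\<forall>t. f differentiable (at t)) \<and> sum_of_products (deriv f)"
  proof induction
    case (prod f g)
    then show ?case
      unfolding deriv_mult_smooth[OF prod]
      by (intro conjI allI differentiable_mult smooth_differentiable
          sum_of_products.sum sum_of_products.prod smooth_deriv)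
  next
    case (sum f g)
    then have "deriv (\<lambda>t. f t + g t) = (\<lambda>t. deriv f t + deriv g t)"
      by (intro ext DERIV_imp_deriv derivative_eq_intros)
         (auto simp: DERIV_deriv_iff_real_differentiable)
    with sum show ?case
      by (auto intro!: sum_of_products.intros differentiable_add)
  qed
qed

lemma smooth_mult: "smooth f \<Longrightarrow> smooth g \<Longrightarrow> smooth (\<lambda>t. f t * g t)"
  by (rule sum_of_products_smooth[OF sum_of_products.prod])

lemma smooth_add:
  assumes "smooth f" "smooth g" shows "smooth (\<lambda>t. f t + g t)"
proof -
  have "sum_of_products (\<lambda>t. f t * 1 + g t * 1)"
    by (intro sum_of_products.sum sum_of_products.prod smooth_const assms)
  then show ?thesis
    using sum_of_products_smooth by simp
qed

text \<open>
  The chain rule produces a constant factor, which the invariant must carry along.\<close>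
lemma smooth_affine:
  assumes "smooth f" shows "smooth (\<lambda>t. f (a * t + b))"
proof (rule smooth_coinduct[of "\<lambda>h. \<exists>c g. smooth g \<and> h = (\<lambda>t. c * g (a * t + b))"])
  show "\<exists>c g. smooth g \<and> (\<lambda>t. f (a * t + b)) = (\<lambda>t. c * g (a * t + b))"
    using assms by (intro exI[of _ 1] exI[of _ f]) simp
next
  fix h assume "\<exists>c g. smooth g \<and> h = (\<lambda>t. c * g (a * t + b))"
  then obtain c g where g: "smooth g" and h: "h = (\<lambda>t. c * g (a * t + b))" by blast
  have d: "(h has_real_derivative (c * a) * deriv g (a * t + b)) (at t)" for t
    unfolding h by (auto intro!: derivative_eq_intros DERIV_chain'[OF _ smooth_DERIV[OF g]])
  then have "deriv h = (\<lambda>t. (c * a) * deriv g (a * t + b))"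
    by (auto intro: DERIV_imp_deriv)
  with d g show "(\<forall>t. h differentiable (at t)) \<and> (\<exists>c g. smooth g \<and> deriv h = (\<lambda>t. c * g (a * t + b)))"
    by (auto simp: real_differentiable_def intro: smooth_deriv)
qed

lemma smooth_exp: "smooth (\<lambda>t. exp (a * t))"
proof (rule smooth_coinduct[of "\<lambda>h. \<exists>c. h = (\<lambda>t. c * exp (a * t))"])
  show "\<exists>c. (\<lambda>t. exp (a * t)) = (\<lambda>t. c * exp (a * t))"
    by (intro exI[of _ 1]) simp
next
  fix h assume "\<exists>c. h = (\<lambda>t. c * exp (a * t))"
  then obtain c where h: "h = (\<lambda>t. c * exp (a * t))" by blast
  have d: "(h has_real_derivative (c * a) * exp (a * t)) (at t)" for t
    unfolding h by (auto intro!: derivative_eq_intros)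
  then have "deriv h = (\<lambda>t. (c * a) * exp (a * t))"
    by (auto intro: DERIV_imp_deriv)
  with d show "(\<forall>t. h differentiable (at t)) \<and> (\<exists>c. deriv h = (\<lambda>t. c * exp (a * t)))"
    by (auto simp: real_differentiable_def)
qed

section \<open>A smooth bump function\<close>

text \<open>
  The classical function \<open>exp (- 1 / t)\<close>, extended by zero to \<open>t \<le> 0\<close>, is smooth but not
  analytic at the origin.  The polynomial factor in \<open>1 / t\<close> makes the family closed under
  differentiation, which turns smoothness into a coinduction.\<close>
definition flat_exp :: "real poly \<Rightarrow> real \<Rightarrow> real" where
  "flat_exp p t = (if t \<le> 0 then 0 else poly p (1 / t) * exp (- (1 / t)))"

lemma poly_div_exp_0: "((\<lambda>x. poly p x * exp (- x)) \<longlongrightarrow> (0::real)) at_top"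
proof -
  have "((\<lambda>x. \<Sum>i\<le>degree p. coeff p i * (x ^ i / exp x)) \<longlongrightarrow> (\<Sum>i\<le>degree p. coeff p i * 0)) at_top"
    by (intro tendsto_intros tendsto_power_div_exp_0)
  then show ?thesis
    by (simp add: poly_altdef sum_divide_distrib exp_minus divide_inverse mult.assoc sum_distrib_right)
qed

text \<open>
  Away from the origin this is calculus, with \<open>d(1 / t) / dt = - (1 / t)\<^sup>2\<close> as the source of the
  factor \<open>[:0, 0, 1:]\<close>.  At the origin the right-hand difference quotient tends to zero because,
  with \<open>x = 1 / t\<close>, the exponential \<open>exp (- x)\<close> beats every polynomial in \<open>x\<close>.\<close>
lemma DERIV_flat_exp: "(flat_exp p has_real_derivative flat_exp ([:0, 0, 1:] * (p - pderiv p)) t) (at t)"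
proof (cases "t = 0")
  case False
  show ?thesis
  proof (cases "t < 0")
    case True
    have "((\<lambda>_. 0) has_real_derivative flat_exp ([:0, 0, 1:] * (p - pderiv p)) t) (at t)"
      using True by (simp add: flat_exp_def)
    then show ?thesis
      by (rule has_field_derivative_transform_within_open[of _ _ _ "{..<0}"])
         (use True in \<open>auto simp: flat_exp_def\<close>)
  next
    case F: False
    have "((\<lambda>t. poly p (1 / t) * exp (- (1 / t))) has_real_derivative
        flat_exp ([:0, 0, 1:] * (p - pderiv p)) t) (at t)"
      using F False
      by (auto intro!: derivative_eq_intros DERIV_chain'[OF _ poly_DERIV]
          simp: flat_exp_def field_simps power2_eq_square)
    then show ?thesis
      by (rule has_field_derivative_transform_within_open[of _ _ _ "{0<..}"])
         (use F False in \<open>auto simp: flat_exp_def\<close>)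
  qed
next
  case True
  have "((\<lambda>h. flat_exp p h / h) \<longlongrightarrow> 0) (at_right 0)"
  proof -
    have "((\<lambda>h. poly ([:0, 1:] * p) (inverse h) * exp (- inverse h)) \<longlongrightarrow> (0::real)) (at_right 0)"
      using filterlim_compose[OF poly_div_exp_0 filterlim_inverse_at_top_right] by blast
    then show ?thesis
      by (rule tendsto_cong[THEN iffD1, rotated])
         (auto simp: eventually_at_right_field flat_exp_def field_simps intro!: exI[of _ 1])
  qed
  moreover have "((\<lambda>h. flat_exp p h / h) \<longlongrightarrow> 0) (at_left 0)"
    by (rule tendsto_eventually) (auto simp: eventually_at_left_field flat_exp_def intro!: exI[of _ "-1"])
  ultimately have "((\<lambda>h. flat_exp p h / h) \<longlongrightarrow> 0) (at 0)"
    by (simp add: filterlim_split_at)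
  then show ?thesis
    using True by (simp add: DERIV_def flat_exp_def)
qed

lemma smooth_flat_exp: "smooth (flat_exp p)"
proof (rule smooth_coinduct[of "\<lambda>h. \<exists>p. h = flat_exp p"])
  fix h assume "\<exists>p. h = flat_exp p"
  then obtain p where h: "h = flat_exp p" by blast
  then have "deriv h = flat_exp ([:0, 0, 1:] * (p - pderiv p))"
    by (intro ext) (simp only: DERIV_imp_deriv[OF DERIV_flat_exp])
  with DERIV_flat_exp show "(\<forall>t. h differentiable (at t)) \<and> (\<exists>p. deriv h = flat_exp p)"
    unfolding h real_differentiable_def by blast
qed auto

text \<open>
  The bump lives strictly to the left of the origin, on \<open>[-2, -1]\<close>.  A cutoff obtained from it by
  integration then equals \<open>1\<close> on a neighbourhood of \<open>[0, \<infinity>)\<close>, and a causal distribution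
  vanishes on it.\<close>
definition bump :: "real \<Rightarrow> real" where
  "bump t = flat_exp 1 (t + 2) * flat_exp 1 (- t - 1)"

lemma smooth_bump: "smooth bump"
  using smooth_mult[OF smooth_affine[OF smooth_flat_exp] smooth_affine[OF smooth_flat_exp], of 1 1 2 1 "-1" "-1"]
  by (simp add: bump_def[abs_def])

lemma bump_pos_iff: "bump t > 0 \<longleftrightarrow> - 2 < t \<and> t < - 1"
  by (auto simp: bump_def flat_exp_def)

section \<open>Test functions and their integrals\<close>

definition vanishes_beyond :: "real \<Rightarrow> (real \<Rightarrow> real) \<Rightarrow> bool" where
  "vanishes_beyond R f \<longleftrightarrow> (\<forall>t. R < \<bar>t\<bar> \<longrightarrow> f t = 0)"

lemma vanishes_beyond_iff: "vanishes_beyond R f \<longleftrightarrow> (\<forall>t. f t \<noteq> 0 \<longrightarrow> \<bar>t\<bar> \<le> R)"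
  unfolding vanishes_beyond_def not_le[symmetric] by blast

lemma vanishes_beyond_iff_support: "vanishes_beyond R f \<longleftrightarrow> {t. f t \<noteq> 0} \<subseteq> {-R..R}"
proof -
  have "t \<in> {-R..R} \<longleftrightarrow> \<bar>t\<bar> \<le> R" for t
    by auto
  then show ?thesis
    unfolding vanishes_beyond_iff by blast
qed

lemma vanishes_beyond_mono: "vanishes_beyond R f \<Longrightarrow> R \<le> S \<Longrightarrow> vanishes_beyond S f"
  unfolding vanishes_beyond_def by auto

lemma vanishes_beyond_funpow_deriv:
  assumes "vanishes_beyond R f" shows "vanishes_beyond R ((deriv ^^ k) f)"
proof (induction k)
  case (Suc k)
  have "deriv ((deriv ^^ k) f) t = 0" if "R < \<bar>t\<bar>" for t
  proof (rule DERIV_imp_deriv)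
    have "open {t::real. R < \<bar>t\<bar>}"
      by (intro open_Collect_less continuous_intros)
    then show "((deriv ^^ k) f has_real_derivative 0) (at t)"
      using that Suc
      by - (rule has_field_derivative_transform_within_open[of "\<lambda>_. 0" 0 t "{t. R < \<bar>t\<bar>}"];
            simp add: vanishes_beyond_def)
  qed
  then show ?case
    by (simp add: vanishes_beyond_def)
qed (use assms in simp)

lemma test_function_iff: "test_function \<phi> \<longleftrightarrow> smooth \<phi> \<and> (\<exists>R. vanishes_beyond R \<phi>)"
  unfolding test_function_def bounded_iff vanishes_beyond_iff by simp

lemma test_function_smooth: "test_function \<phi> \<Longrightarrow> smooth \<phi>"
  by (simp add: test_function_def)

lemma test_function_vanishes:
  assumes "test_function \<phi>"
  obtains R where "vanishes_beyond R \<phi>" "R > a"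
proof -
  obtain R where "vanishes_beyond R \<phi>"
    using assms[unfolded test_function_iff] by blast
  then have "vanishes_beyond (max R (a + 1)) \<phi>"
    by (rule vanishes_beyond_mono) simp
  then show thesis
    by (rule that) simp
qed

lemma vanishes_beyond_mult: "vanishes_beyond R \<phi> \<Longrightarrow> vanishes_beyond R (\<lambda>t. g t * \<phi> t)"
  by (simp add: vanishes_beyond_def)

lemma test_functionI: "smooth \<phi> \<Longrightarrow> vanishes_beyond R \<phi> \<Longrightarrow> test_function \<phi>"
  by (auto simp: test_function_iff)

lemma test_function_mult:
  assumes "smooth g" "test_function \<phi>" shows "test_function (\<lambda>t. g t * \<phi> t)"
proof -
  obtain R where "vanishes_beyond R \<phi>"
    using assms(2) by (rule test_function_vanishes)
  then show ?thesis
    by (rule test_functionI[OF smooth_mult[OF assms(1) test_function_smooth[OF assms(2)]] vanishes_beyond_mult])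
qed

lemma test_function_cmult: "test_function \<phi> \<Longrightarrow> test_function (\<lambda>t. c * \<phi> t)"
  by (intro test_function_mult smooth_const)

lemma test_function_add:
  assumes "test_function \<phi>" "test_function \<psi>" shows "test_function (\<lambda>t. \<phi> t + \<psi> t)"
proof -
  obtain R where R: "vanishes_beyond R \<phi>" "R > 0"
    using assms(1) by (rule test_function_vanishes)
  obtain S where S: "vanishes_beyond S \<psi>" "S > R"
    using assms(2) by (rule test_function_vanishes)
  have "vanishes_beyond S (\<lambda>t. \<phi> t + \<psi> t)"
    using R S by (auto simp: vanishes_beyond_def)
  then show ?thesis
    by (rule test_functionI[OF smooth_add[OF assms[THEN test_function_smooth]]])
qed

lemma test_function_deriv:
  assumes "test_function \<phi>" shows "test_function (deriv \<phi>)"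
proof -
  obtain R where "vanishes_beyond R \<phi>"
    using assms by (rule test_function_vanishes)
  then have "vanishes_beyond R (deriv \<phi>)"
    using vanishes_beyond_funpow_deriv[of R \<phi> 1] by simp
  then show ?thesis
    by (rule test_functionI[OF smooth_deriv[OF test_function_smooth[OF assms]]])
qed

lemma test_function_zero: "test_function (\<lambda>t. 0)"
  by (auto simp: test_function_iff vanishes_beyond_def smooth_const)

lemma has_integral_atLeast_antiderivative:
  fixes \<phi> :: "real \<Rightarrow> real"
  assumes "\<And>t. (\<Phi> has_real_derivative \<phi> t) (at t)" and "\<And>t. b < t \<Longrightarrow> \<phi> t = 0" and "s \<le> b"
  shows "(\<phi> has_integral \<Phi> b - \<Phi> s) {s..}"
proof -
  have "(\<phi> has_integral \<Phi> b - \<Phi> s) {s..b}"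
    by (intro fundamental_theorem_of_calculus assms)
       (simp add: assms(1) has_field_derivative_at_within flip: has_real_derivative_iff_has_vector_derivative)
  then have "((\<lambda>t. if t \<in> {s..b} then \<phi> t else 0) has_integral \<Phi> b - \<Phi> s) {s..}"
    by (intro has_integral_restrict[THEN iffD2]) auto
  then show ?thesis
    by (rule has_integral_eq[rotated]) (use assms(2) in auto)
qed

text \<open>
  The integral is started at \<open>a - 1\<close> rather than at \<open>a\<close>, so that every point from \<open>a\<close> onwards
  is interior to the interval of integration and has a two-sided derivative.\<close>
lemma antiderivative_from:
  fixes f :: "real \<Rightarrow> real"
  assumes "continuous_on UNIV f" and "\<And>t. t < a \<Longrightarrow> f t = 0"
  obtains F where "\<And>t. (F has_real_derivative f t) (at t)" and "\<And>t. t < a \<Longrightarrow> F t = 0"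
proof -
  define F where "F = (\<lambda>t. integral {a - 1..t} f)"
  have zero: "F t = 0" if "t < a" for t
    unfolding F_def using that assms(2) by (intro integral_unique[OF has_integral_is_0]) auto
  have "(F has_real_derivative f t) (at t)" for t
  proof (cases "t < a")
    case True
    have "(F has_real_derivative 0) (at t)"
      by (rule has_field_derivative_transform_within_open[of "\<lambda>_. 0" 0 t "{..<a}"])
         (use True zero in auto)
    with True assms(2) show ?thesis by simp
  next
    case False
    have "(F has_real_derivative f t) (at t within {a - 1..t + 1})"
      unfolding F_def using False assms(1)
      by (intro integral_has_real_derivative) (auto intro: continuous_on_subset)
    moreover have "t \<in> interior {a - 1..t + 1}"
      using False by simp
    ultimately show ?thesis
      by (simp only: at_within_interior)
  qed
  then show thesis
    using zero that by blast
qed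

lemma DERIV_tail_integral:
  assumes "test_function \<phi>"
  shows "((\<lambda>s. integral {s..} \<phi>) has_real_derivative - \<phi> s) (at s)"
proof -
  obtain R where R: "vanishes_beyond R \<phi>" "R > s"
    using assms by (rule test_function_vanishes)
  have zero: "\<phi> t = 0" if "t < - R" for t
    using R that by (auto simp: vanishes_beyond_def)
  obtain F where F: "\<And>t. (F has_real_derivative \<phi> t) (at t)"
    using antiderivative_from[OF smooth_continuous_on[OF test_function_smooth[OF assms]] zero] by blast
  have tail: "F R - F r = integral {r..} \<phi>" if "r < R" for r
  proof -
    have "(\<phi> has_integral F R - F r) {r..}"
      by (rule has_integral_atLeast_antiderivative[OF F])
         (use R that in \<open>auto simp: vanishes_beyond_def\<close>)
    then show ?thesis by (simp add: integral_unique)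
  qed
  have "((\<lambda>s. F R - F s) has_real_derivative - \<phi> s) (at s)"
    by (auto intro!: derivative_eq_intros F)
  then show ?thesis
    by (rule has_field_derivative_transform_within_open[of _ _ _ "{..<R}"])
       (use \<open>R > s\<close> tail in auto)
qed

lemma smooth_tail_integral:
  assumes "test_function \<phi>" shows "smooth (\<lambda>s. integral {s..} \<phi>)"
proof (rule smoothI_DERIV[OF DERIV_tail_integral[OF assms]])
  show "smooth (\<lambda>s. - \<phi> s)"
    using smooth_mult[OF smooth_const[of "-1"] test_function_smooth[OF assms]] by simp
qed

lemma tail_integral_eq_0:
  "vanishes_beyond R \<phi> \<Longrightarrow> R < s \<Longrightarrow> integral {s..} \<phi> = 0"
  by (intro integral_unique[OF has_integral_is_0]) (auto simp: vanishes_beyond_def)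

lemma tail_integral_eq_UNIV:
  "vanishes_beyond R \<phi> \<Longrightarrow> s \<le> - R \<Longrightarrow> integral {s..} \<phi> = integral UNIV \<phi>"
  by (rule integral_spike_set) (auto simp: vanishes_beyond_def intro!: empty_imp_negligible)

text \<open>
  Together with the definition of the running integral this is the fundamental theorem of
  calculus for distributions.\<close>
lemma tail_integral_deriv:
  assumes "test_function \<phi>"
  shows "integral {s..} (deriv \<phi>) = - \<phi> s"
proof -
  obtain R where R: "vanishes_beyond R \<phi>" "R > s"
    using assms by (rule test_function_vanishes)
  obtain S where S: "vanishes_beyond S (deriv \<phi>)" "S > R"
    using test_function_deriv[OF assms] by (rule test_function_vanishes)
  have "(deriv \<phi> has_integral \<phi> S - \<phi> s) {s..}"
    using R S by (intro has_integral_atLeast_antiderivative smooth_DERIV test_function_smooth assms)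
      (auto simp: vanishes_beyond_def)
  then show ?thesis
    using R S by (auto simp: vanishes_beyond_def integral_unique)
qed

section \<open>A smooth cutoff\<close>

lemma test_function_bump: "test_function bump" and vanishes_beyond_bump: "vanishes_beyond 2 bump"
proof -
  show "vanishes_beyond 2 bump"
    by (auto simp: vanishes_beyond_def bump_def flat_exp_def)
  then show "test_function bump"
    by (rule test_functionI[OF smooth_bump])
qed

lemma bump_integral_pos: "integral UNIV bump > 0"
proof -
  let ?T = "\<lambda>s. integral {s..} bump"
  have "\<exists>z>-2. z < - 1 \<and> ?T (- 1) - ?T (- 2) = (- 1 - (- 2)) * (- bump z)"
    by (rule MVT2) (simp_all add: DERIV_tail_integral[OF test_function_bump])
  then obtain z where z: "- 2 < z" "z < - 1" "?T (- 1) - ?T (- 2) = - bump z"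
    by auto
  have "?T (- 1) = 0"
    by (intro integral_unique[OF has_integral_is_0]) (auto simp: bump_def flat_exp_def)
  moreover have "?T (- 2) = integral UNIV bump"
    using vanishes_beyond_bump by (intro tail_integral_eq_UNIV) auto
  ultimately show ?thesis
    using z bump_pos_iff[of z] by simp
qed

text \<open>
  A smooth transition from \<open>0\<close> (left of \<open>-2\<close>) to \<open>1\<close> (right of \<open>-1\<close>).  Multiplying the
  integral of a test function from \<open>s\<close> to infinity by it yields an explicit test function of the
  kind that the running integral of a distribution selects.\<close>
definition cutoff :: "real \<Rightarrow> real" where
  "cutoff s = 1 - integral {s..} bump / integral UNIV bump"

lemma smooth_cutoff: "smooth cutoff"
  using smooth_add[OF smooth_const[of 1] smooth_mult[OF smooth_const smooth_tail_integral[OF test_function_bump]],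
      of "- 1 / integral UNIV bump"]
  by (simp add: cutoff_def[abs_def])

lemma cutoff_eq_0: "s \<le> - 2 \<Longrightarrow> cutoff s = 0"
  using tail_integral_eq_UNIV[OF vanishes_beyond_bump] bump_integral_pos by (simp add: cutoff_def)

lemma cutoff_eq_1: "- 1 \<le> s \<Longrightarrow> cutoff s = 1"
  by (auto simp: cutoff_def bump_def flat_exp_def intro!: integral_unique[OF has_integral_is_0])

section \<open>Bounds for derivatives of products\<close>

lemma funpow_deriv_add:
  assumes "smooth f" "smooth g"
  shows "(deriv ^^ k) (\<lambda>t. f t + g t) = (\<lambda>t. (deriv ^^ k) f t + (deriv ^^ k) g t)"
proof (induction k)
  case (Suc k)
  have "deriv (\<lambda>t. (deriv ^^ k) f t + (deriv ^^ k) g t) t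
      = deriv ((deriv ^^ k) f) t + deriv ((deriv ^^ k) g) t" for t
    by (rule DERIV_imp_deriv[OF DERIV_add]; rule smooth_DERIV[OF smooth_funpow_deriv]; fact)
  then show ?case
    by (simp add: Suc)
qed simp

lemma funpow_deriv_cmult:
  assumes "smooth f"
  shows "(deriv ^^ k) (\<lambda>t. c * f t) = (\<lambda>t. c * (deriv ^^ k) f t)"
proof (induction k)
  case (Suc k)
  have "deriv (\<lambda>t. c * (deriv ^^ k) f t) t = c * deriv ((deriv ^^ k) f) t" for t
    by (rule DERIV_imp_deriv[OF DERIV_cmult]; rule smooth_DERIV[OF smooth_funpow_deriv]; fact)
  then show ?case
    by (simp add: Suc)
qed simp

text \<open>
  Differentiating the product once and applying
  the induction hypothesis to \<open>m' f\<close> and \<open>m f'\<close> avoids the Leibniz formula.  The bound is local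
  to \<open>[-R, R]\<close> because it is also applied to functions \<open>f\<close> without compact support.\<close>
lemma funpow_deriv_mult_bound:
  assumes "smooth m"
  shows "\<exists>M\<ge>0. \<forall>f B. smooth f \<longrightarrow> (\<forall>j\<le>k. \<forall>t\<in>{-R..R}. \<bar>(deriv ^^ j) f t\<bar> \<le> B) \<longrightarrow>
           (\<forall>t\<in>{-R..R}. \<bar>(deriv ^^ k) (\<lambda>t. m t * f t) t\<bar> \<le> M * B)"
  using assms
proof (induction k arbitrary: m)
  case 0
  have "bounded (m ` {-R..R})"
    by (intro compact_imp_bounded compact_continuous_image smooth_continuous_on 0 compact_Icc)
  then obtain M where M: "M > 0" "\<And>t. t \<in> {-R..R} \<Longrightarrow> \<bar>m t\<bar> \<le> M"
    unfolding bounded_pos by auto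
  show ?case
    using M by (intro exI[of _ M]) (auto simp: abs_mult intro!: mult_mono)
next
  case (Suc k)
  from Suc.IH[OF Suc.prems] obtain M1 where M1: "M1 \<ge> 0"
    "\<And>f B t. smooth f \<Longrightarrow> (\<And>j t. j \<le> k \<Longrightarrow> t \<in> {-R..R} \<Longrightarrow> \<bar>(deriv ^^ j) f t\<bar> \<le> B)
      \<Longrightarrow> t \<in> {-R..R} \<Longrightarrow> \<bar>(deriv ^^ k) (\<lambda>t. m t * f t) t\<bar> \<le> M1 * B"
    by blast
  from Suc.IH[OF smooth_deriv[OF Suc.prems]] obtain M2 where M2: "M2 \<ge> 0"
    "\<And>f B t. smooth f \<Longrightarrow> (\<And>j t. j \<le> k \<Longrightarrow> t \<in> {-R..R} \<Longrightarrow> \<bar>(deriv ^^ j) f t\<bar> \<le> B)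
      \<Longrightarrow> t \<in> {-R..R} \<Longrightarrow> \<bar>(deriv ^^ k) (\<lambda>t. deriv m t * f t) t\<bar> \<le> M2 * B"
    by blast
  have "\<bar>(deriv ^^ Suc k) (\<lambda>t. m t * f t) t\<bar> \<le> (M1 + M2) * B"
    if f: "smooth f" and B: "\<forall>j\<le>Suc k. \<forall>t\<in>{-R..R}. \<bar>(deriv ^^ j) f t\<bar> \<le> B"
      and t: "t \<in> {-R..R}" for f B t
  proof -
    have "(deriv ^^ Suc k) (\<lambda>t. m t * f t) t
        = (deriv ^^ k) (\<lambda>t. deriv m t * f t) t + (deriv ^^ k) (\<lambda>t. m t * deriv f t) t"
      by (simp only: funpow_Suc_right o_apply deriv_mult_smooth[OF Suc.prems f]
          funpow_deriv_add[OF smooth_mult[OF smooth_deriv[OF Suc.prems] f]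
            smooth_mult[OF Suc.prems smooth_deriv[OF f]]])
    moreover have "\<bar>(deriv ^^ k) (\<lambda>t. deriv m t * f t) t\<bar> \<le> M2 * B"
      by (rule M2(2)[OF f _ t]) (use B in auto)
    moreover have "\<bar>(deriv ^^ k) (\<lambda>t. m t * deriv f t) t\<bar> \<le> M1 * B"
    proof (rule M1(2)[OF smooth_deriv[OF f] _ t])
      fix j t assume "j \<le> k" "t \<in> {-R..R}"
      then have "\<bar>(deriv ^^ Suc j) f t\<bar> \<le> B"
        using B by (meson Suc_le_mono)
      then show "\<bar>(deriv ^^ j) (deriv f) t\<bar> \<le> B"
        by (simp only: funpow_Suc_right o_apply)
    qed
    ultimately show ?thesis
      by (simp add: distrib_right)
  qed
  then show ?case
    using M1(1) M2(1) by (intro exI[of _ "M1 + M2"]) auto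
qed

lemma funpow_deriv_mult_bound_upto:
  assumes "smooth m"
  obtains M where "\<And>f B k t. smooth f \<Longrightarrow>
      (\<And>j t. j \<le> N \<Longrightarrow> t \<in> {-R..R} \<Longrightarrow> \<bar>(deriv ^^ j) f t\<bar> \<le> B) \<Longrightarrow> B \<ge> 0 \<Longrightarrow>
      k \<le> N \<Longrightarrow> t \<in> {-R..R} \<Longrightarrow> \<bar>(deriv ^^ k) (\<lambda>t. m t * f t) t\<bar> \<le> M * B"
proof -
  have "\<forall>k. \<exists>M\<ge>0. \<forall>f B. smooth f \<longrightarrow>
      (\<forall>j\<le>k. \<forall>t\<in>{-R..R}. \<bar>(deriv ^^ j) f t\<bar> \<le> B) \<longrightarrow>
      (\<forall>t\<in>{-R..R}. \<bar>(deriv ^^ k) (\<lambda>t. m t * f t) t\<bar> \<le> M * B)"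
    by (rule allI, rule funpow_deriv_mult_bound[OF assms])
  from choice[OF this] obtain M where M: "\<And>k. M k \<ge> 0"
    "\<And>k f B t. smooth f \<Longrightarrow> (\<forall>j\<le>k. \<forall>t\<in>{-R..R}. \<bar>(deriv ^^ j) f t\<bar> \<le> B) \<Longrightarrow>
        t \<in> {-R..R} \<Longrightarrow> \<bar>(deriv ^^ k) (\<lambda>t. m t * f t) t\<bar> \<le> M k * B"
    by blast
  show thesis
  proof (rule that[of "\<Sum>k\<le>N. M k"])
    fix f B k t
    assume f: "smooth f" "\<And>j t. j \<le> N \<Longrightarrow> t \<in> {-R..R} \<Longrightarrow> \<bar>(deriv ^^ j) f t\<bar> \<le> B"
      and "B \<ge> (0::real)" and k: "k \<le> N" and t: "t \<in> {-R..R}"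
    have "\<bar>(deriv ^^ k) (\<lambda>t. m t * f t) t\<bar> \<le> M k * B"
      using f k t by (intro M(2)) auto
    also have "\<dots> \<le> (\<Sum>k\<le>N. M k) * B"
      using k M(1) \<open>B \<ge> 0\<close> by (intro mult_right_mono member_le_sum) auto
    finally show "\<bar>(deriv ^^ k) (\<lambda>t. m t * f t) t\<bar> \<le> (\<Sum>k\<le>N. M k) * B" .
  qed
qed

section \<open>Distributions and their smooth multiples\<close>

lemma dist_add_test: "is_distribution T \<Longrightarrow> test_function \<phi> \<Longrightarrow> test_function \<psi> \<Longrightarrow>
    T (\<lambda>t. \<phi> t + \<psi> t) = T \<phi> + T \<psi>"
  by (simp add: is_distribution_def)

lemma dist_cmult_test: "is_distribution T \<Longrightarrow> test_function \<phi> \<Longrightarrow> T (\<lambda>t. c * \<phi> t) = c * T \<phi>"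
  by (simp add: is_distribution_def)

lemma dist_diff_test:
  assumes "is_distribution T" "test_function \<phi>" "test_function \<psi>"
  shows "T (\<lambda>t. \<phi> t - \<psi> t) = T \<phi> - T \<psi>"
  using dist_add_test[OF assms(1,2) test_function_cmult[OF assms(3)], of "-1"]
    dist_cmult_test[OF assms(1,3), of "-1"] by simp

lemma bdd_above_funpow_deriv:
  assumes "test_function \<phi>"
  shows "bdd_above (range (\<lambda>t. \<bar>(deriv ^^ k) \<phi> t\<bar>))"
proof -
  obtain R where R: "vanishes_beyond R \<phi>" "R > 0"
    using assms by (rule test_function_vanishes)
  have "bounded ((deriv ^^ k) \<phi> ` {-R..R})"
    by (intro compact_imp_bounded compact_continuous_image compact_Icc
        smooth_continuous_on[OF smooth_funpow_deriv[OF test_function_smooth[OF assms]]])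
  then obtain M where M: "M > 0" "\<And>t. t \<in> {-R..R} \<Longrightarrow> \<bar>(deriv ^^ k) \<phi> t\<bar> \<le> M"
    unfolding bounded_pos by auto
  have "\<bar>(deriv ^^ k) \<phi> t\<bar> \<le> M" for t
    using M vanishes_beyond_funpow_deriv[OF R(1), of k]
    by (cases "t \<in> {-R..R}") (auto simp: vanishes_beyond_def)
  then show ?thesis
    by (intro bdd_aboveI[of _ M]) auto
qed

text \<open>
  A common bound \<open>B\<close> on the derivatives is easier to propagate than the sum of their suprema;
  up to the factor \<open>N + 1\<close> in the converse below, the two forms of continuity agree.\<close>
lemma is_distributionI:
  assumes add: "\<And>\<phi> \<psi>. test_function \<phi> \<Longrightarrow> test_function \<psi> \<Longrightarrow> T (\<lambda>t. \<phi> t + \<psi> t) = T \<phi> + T \<psi>"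
    and cmult: "\<And>c \<phi>. test_function \<phi> \<Longrightarrow> T (\<lambda>t. c * \<phi> t) = c * T \<phi>"
    and bound: "\<And>R. \<exists>C N. \<forall>\<phi> B. test_function \<phi> \<longrightarrow> vanishes_beyond R \<phi> \<longrightarrow> B \<ge> 0 \<longrightarrow>
        (\<forall>k\<le>N. \<forall>t. \<bar>(deriv ^^ k) \<phi> t\<bar> \<le> B) \<longrightarrow> \<bar>T \<phi>\<bar> \<le> C * B"
  shows "is_distribution T"
proof -
  have "\<exists>C N. \<forall>\<phi>. test_function \<phi> \<longrightarrow> {t. \<phi> t \<noteq> 0} \<subseteq> {-R..R} \<longrightarrow>
      \<bar>T \<phi>\<bar> \<le> C * (\<Sum>k\<le>N. SUP t. \<bar>(deriv ^^ k) \<phi> t\<bar>)" for R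
  proof -
    obtain C N where CN: "\<And>\<phi> B. test_function \<phi> \<Longrightarrow> vanishes_beyond R \<phi> \<Longrightarrow> B \<ge> 0 \<Longrightarrow>
        (\<forall>k\<le>N. \<forall>t. \<bar>(deriv ^^ k) \<phi> t\<bar> \<le> B) \<Longrightarrow> \<bar>T \<phi>\<bar> \<le> C * B"
      using bound[of R] by blast
    have "\<bar>T \<phi>\<bar> \<le> C * (\<Sum>k\<le>N. SUP t. \<bar>(deriv ^^ k) \<phi> t\<bar>)"
      if \<phi>: "test_function \<phi>" "vanishes_beyond R \<phi>" for \<phi>
    proof (rule CN[OF \<phi>])
      have le: "\<bar>(deriv ^^ k) \<phi> t\<bar> \<le> (SUP t. \<bar>(deriv ^^ k) \<phi> t\<bar>)" for k t
        by (rule cSUP_upper[OF _ bdd_above_funpow_deriv[OF \<phi>(1)]]) simp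
      then have nonneg: "0 \<le> (SUP t. \<bar>(deriv ^^ k) \<phi> t\<bar>)" for k
        by (meson abs_ge_zero order_trans)
      show "(\<Sum>k\<le>N. SUP t. \<bar>(deriv ^^ k) \<phi> t\<bar>) \<ge> 0"
        by (rule sum_nonneg) (rule nonneg)
      have "(SUP t. \<bar>(deriv ^^ k) \<phi> t\<bar>) \<le> (\<Sum>k\<le>N. SUP t. \<bar>(deriv ^^ k) \<phi> t\<bar>)" if "k \<le> N" for k
        using that nonneg by (intro member_le_sum) auto
      then show "\<forall>k\<le>N. \<forall>t. \<bar>(deriv ^^ k) \<phi> t\<bar> \<le> (\<Sum>k\<le>N. SUP t. \<bar>(deriv ^^ k) \<phi> t\<bar>)"
        using le order_trans by blast
    qed
    then show ?thesis
      unfolding vanishes_beyond_iff_support by blast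
  qed
  then show ?thesis
    unfolding is_distribution_def using add cmult by simp
qed

lemma is_distribution_bound:
  assumes "is_distribution T"
  obtains C N where "C \<ge> 0" and "\<And>\<phi> B. test_function \<phi> \<Longrightarrow> vanishes_beyond R \<phi> \<Longrightarrow>
      (\<And>k t. k \<le> N \<Longrightarrow> \<bar>(deriv ^^ k) \<phi> t\<bar> \<le> B) \<Longrightarrow> \<bar>T \<phi>\<bar> \<le> C * B"
proof -
  obtain C N where CN: "\<And>\<phi>. test_function \<phi> \<Longrightarrow> vanishes_beyond R \<phi> \<Longrightarrow>
      \<bar>T \<phi>\<bar> \<le> C * (\<Sum>k\<le>N. SUP t. \<bar>(deriv ^^ k) \<phi> t\<bar>)"
    using assms unfolding is_distribution_def vanishes_beyond_iff_support by blast
  show thesis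
  proof (rule that[of "\<bar>C\<bar> * real (Suc N)" N])
    fix \<phi> B
    assume \<phi>: "test_function \<phi>" "vanishes_beyond R \<phi>"
      and B: "\<And>k t. k \<le> N \<Longrightarrow> \<bar>(deriv ^^ k) \<phi> t\<bar> \<le> B"
    have "(SUP t. \<bar>(deriv ^^ k) \<phi> t\<bar>) \<le> B" if "k \<le> N" for k
      by (rule cSUP_least) (use B that in auto)
    then have sum: "(\<Sum>k\<le>N. SUP t. \<bar>(deriv ^^ k) \<phi> t\<bar>) \<le> (\<Sum>k\<le>N. B)"
      by (intro sum_mono) auto
    have "0 \<le> (SUP t. \<bar>(deriv ^^ k) \<phi> t\<bar>)" for k
      by (rule cSUP_upper2[OF bdd_above_funpow_deriv[OF \<phi>(1)], of 0]) auto
    then have nonneg: "0 \<le> (\<Sum>k\<le>N. SUP t. \<bar>(deriv ^^ k) \<phi> t\<bar>)"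
      by (rule sum_nonneg)
    have "\<bar>T \<phi>\<bar> \<le> C * (\<Sum>k\<le>N. SUP t. \<bar>(deriv ^^ k) \<phi> t\<bar>)"
      by (rule CN[OF \<phi>])
    also have "\<dots> \<le> \<bar>C\<bar> * (\<Sum>k\<le>N. SUP t. \<bar>(deriv ^^ k) \<phi> t\<bar>)"
      using nonneg by (intro mult_right_mono) auto
    also have "\<dots> \<le> \<bar>C\<bar> * (\<Sum>k\<le>N. B)"
      using sum by (intro mult_left_mono) auto
    finally show "\<bar>T \<phi>\<bar> \<le> \<bar>C\<bar> * real (Suc N) * B"
      by (simp add: mult.assoc)
  qed simp
qed

lemma is_distribution_cong:
  assumes "is_distribution T" "S =\<^sub>D T" shows "is_distribution S"
proof -
  have "S \<phi> = T \<phi>" if "test_function \<phi>" for \<phi>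
    using assms(2) that by (simp add: dist_eq_def)
  then show ?thesis
    using assms(1) unfolding is_distribution_def
    by (simp add: test_function_add test_function_cmult)
qed

lemma is_distribution_fun_mult:
  assumes "smooth g" "is_distribution T" shows "is_distribution (g *\<^sub>D T)"
proof (rule is_distributionI)
  fix \<phi> \<psi> assume "test_function \<phi>" "test_function \<psi>"
  then show "(g *\<^sub>D T) (\<lambda>t. \<phi> t + \<psi> t) = (g *\<^sub>D T) \<phi> + (g *\<^sub>D T) \<psi>"
    by (simp add: fun_mult_def distrib_left dist_add_test[OF assms(2)] test_function_mult[OF assms(1)])
next
  fix c \<phi> assume "test_function \<phi>"
  then show "(g *\<^sub>D T) (\<lambda>t. c * \<phi> t) = c * (g *\<^sub>D T) \<phi>"
    using dist_cmult_test[OF assms(2) test_function_mult[OF assms(1)], of \<phi> c]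
    by (simp add: fun_mult_def mult.left_commute)
next
  fix R
  obtain C N where C: "C \<ge> 0" and CN: "\<And>\<phi> B. test_function \<phi> \<Longrightarrow> vanishes_beyond R \<phi> \<Longrightarrow>
      (\<And>k t. k \<le> N \<Longrightarrow> \<bar>(deriv ^^ k) \<phi> t\<bar> \<le> B) \<Longrightarrow> \<bar>T \<phi>\<bar> \<le> C * B"
    using is_distribution_bound[OF assms(2)] by blast
  obtain M where M: "\<And>f B k t. smooth f \<Longrightarrow>
      (\<And>j t. j \<le> N \<Longrightarrow> t \<in> {-R..R} \<Longrightarrow> \<bar>(deriv ^^ j) f t\<bar> \<le> B) \<Longrightarrow> B \<ge> 0 \<Longrightarrow>
      k \<le> N \<Longrightarrow> t \<in> {-R..R} \<Longrightarrow> \<bar>(deriv ^^ k) (\<lambda>t. g t * f t) t\<bar> \<le> M * B"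
    using funpow_deriv_mult_bound_upto[OF assms(1)] by blast
  have "\<bar>(g *\<^sub>D T) \<phi>\<bar> \<le> C * \<bar>M\<bar> * B"
    if \<phi>: "test_function \<phi>" "vanishes_beyond R \<phi>" and "B \<ge> 0"
      and B: "\<forall>k\<le>N. \<forall>t. \<bar>(deriv ^^ k) \<phi> t\<bar> \<le> B" for \<phi> B
  proof -
    note g\<phi> = test_function_mult[OF assms(1) \<phi>(1)] vanishes_beyond_mult[OF \<phi>(2), of g]
    have "\<bar>(deriv ^^ k) (\<lambda>t. g t * \<phi> t) t\<bar> \<le> \<bar>M\<bar> * B" if "k \<le> N" for k t
    proof (cases "t \<in> {-R..R}")
      case True
      have "\<bar>(deriv ^^ k) (\<lambda>t. g t * \<phi> t) t\<bar> \<le> M * B"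
        by (rule M[OF test_function_smooth[OF \<phi>(1)] _ \<open>B \<ge> 0\<close> that True]) (use B in auto)
      also have "\<dots> \<le> \<bar>M\<bar> * B"
        using \<open>B \<ge> 0\<close> by (intro mult_right_mono) auto
      finally show ?thesis .
    next
      case False
      then have "(deriv ^^ k) (\<lambda>t. g t * \<phi> t) t = 0"
        using vanishes_beyond_funpow_deriv[OF g\<phi>(2), of k] by (auto simp: vanishes_beyond_def)
      then show ?thesis
        using \<open>B \<ge> 0\<close> by simp
    qed
    then have "\<bar>T (\<lambda>t. g t * \<phi> t)\<bar> \<le> C * (\<bar>M\<bar> * B)"
      by (rule CN[OF g\<phi>])
    then show ?thesis
      by (simp add: fun_mult_def mult.assoc)
  qed
  then show "\<exists>C N. \<forall>\<phi> B. test_function \<phi> \<longrightarrow> vanishes_beyond R \<phi> \<longrightarrow> B \<ge> 0 \<longrightarrow>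
        (\<forall>k\<le>N. \<forall>t. \<bar>(deriv ^^ k) \<phi> t\<bar> \<le> B) \<longrightarrow> \<bar>(g *\<^sub>D T) \<phi>\<bar> \<le> C * B"
    by blast
qed

section \<open>Causal distributions and the running integral\<close>

lemma fun_mult_apply: "(g *\<^sub>D T) \<phi> = T (\<lambda>t. g t * \<phi> t)"
  by (simp add: fun_mult_def)

text \<open>
  A compact subset of the open half-line \<open>t < 0\<close> has a positive distance from \<open>0\<close>.\<close>
lemma causal_iff:
  "causal T \<longleftrightarrow> (\<forall>\<phi> \<epsilon>. test_function \<phi> \<longrightarrow> \<epsilon> > 0 \<longrightarrow> (\<forall>t>-\<epsilon>. \<phi> t = 0) \<longrightarrow> T \<phi> = 0)"
proof -
  have "closure {t. \<phi> t \<noteq> 0} \<subseteq> {..<0} \<longleftrightarrow> (\<exists>\<epsilon>>0. \<forall>t>-\<epsilon>. \<phi> t = 0)"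
    if "test_function \<phi>" for \<phi> :: "real \<Rightarrow> real"
  proof
    assume neg: "closure {t. \<phi> t \<noteq> 0} \<subseteq> {..<0}"
    show "\<exists>\<epsilon>>0. \<forall>t>-\<epsilon>. \<phi> t = 0"
    proof (cases "{t. \<phi> t \<noteq> 0} = {}")
      case True
      then show ?thesis by (intro exI[of _ 1]) auto
    next
      case False
      have bdd: "bdd_above {t. \<phi> t \<noteq> 0}"
        using that bounded_imp_bdd_above by (auto simp: test_function_def)
      have "Sup {t. \<phi> t \<noteq> 0} < 0"
        using closure_contains_Sup[OF False bdd] neg by auto
      moreover have "\<phi> t = 0" if "t > Sup {t. \<phi> t \<noteq> 0}" for t
        using cSup_upper[OF _ bdd, of t] that by fastforce
      ultimately show ?thesis
        by (intro exI[of _ "- Sup {t. \<phi> t \<noteq> 0}"]) auto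
    qed
  next
    assume "\<exists>\<epsilon>>0. \<forall>t>-\<epsilon>. \<phi> t = 0"
    then obtain \<epsilon> where \<epsilon>: "\<epsilon> > 0" "\<And>t. t > - \<epsilon> \<Longrightarrow> \<phi> t = 0"
      by blast
    have "{t. \<phi> t \<noteq> 0} \<subseteq> {..-\<epsilon>}"
      using \<epsilon>(2) not_less by auto
    then have "closure {t. \<phi> t \<noteq> 0} \<subseteq> {..-\<epsilon>}"
      by (intro closure_minimal) auto
    then show "closure {t. \<phi> t \<noteq> 0} \<subseteq> {..<0}"
      using \<epsilon>(1) by auto
  qed
  then show ?thesis
    unfolding causal_def by blast
qed

lemma causal_apply_eq_0: "causal T \<Longrightarrow> test_function \<phi> \<Longrightarrow> \<epsilon> > 0 \<Longrightarrow> (\<And>t. t > - \<epsilon> \<Longrightarrow> \<phi> t = 0) \<Longrightarrow> T \<phi> = 0"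
  unfolding causal_iff by blast

lemma causal_fun_mult:
  assumes "smooth g" "causal T" shows "causal (g *\<^sub>D T)"
  unfolding causal_iff fun_mult_apply
proof (intro allI impI)
  fix \<phi> \<epsilon> assume "test_function \<phi>" "\<epsilon> > 0" "\<forall>t>-\<epsilon>. \<phi> t = (0::real)"
  then show "T (\<lambda>t. g t * \<phi> t) = 0"
    by (intro causal_apply_eq_0[OF assms(2) test_function_mult[OF assms(1)], of \<phi> \<epsilon>]) auto
qed

lemma causal_cong: "causal T \<Longrightarrow> S =\<^sub>D T \<Longrightarrow> causal S"
  unfolding causal_def dist_eq_def by simp

lemma test_function_cutoff_tail:
  assumes "test_function \<phi>" "vanishes_beyond R \<phi>" "R \<ge> 2"
  shows "test_function (\<lambda>s. cutoff s * integral {s..} \<phi>)"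
    and "vanishes_beyond R (\<lambda>s. cutoff s * integral {s..} \<phi>)"
proof -
  show van: "vanishes_beyond R (\<lambda>s. cutoff s * integral {s..} \<phi>)"
    using tail_integral_eq_0[OF assms(2)] cutoff_eq_0 assms(3)
    by (auto simp: vanishes_beyond_def abs_real_def split: if_splits)
  show "test_function (\<lambda>s. cutoff s * integral {s..} \<phi>)"
    by (rule test_functionI[OF smooth_mult[OF smooth_cutoff smooth_tail_integral[OF assms(1)]] van])
qed

text \<open>
  Two admissible test functions differ by one supported strictly to the left of \<open>0\<close>, which a
  causal distribution annihilates.  Hence the arbitrary choice in the definition can be replaced by
  any convenient one.\<close>
lemma integral_from_0_eq:
  assumes "is_distribution T" "causal T"
    and \<psi>: "test_function \<psi>" "\<epsilon> > 0" "\<And>s. s > - \<epsilon> \<Longrightarrow> \<psi> s = integral {s..} \<phi>"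
  shows "integral_from_0 T \<phi> = T \<psi>"
proof -
  let ?P = "\<lambda>\<psi>. test_function \<psi> \<and> (\<exists>\<epsilon>>0. \<forall>s>-\<epsilon>. \<psi> s = integral {s..} \<phi>)"
  have "?P (SOME \<psi>. ?P \<psi>)"
    by (rule someI[of ?P \<psi>]) (use \<psi> in blast)
  then obtain \<delta> where \<delta>: "test_function (SOME \<psi>. ?P \<psi>)" "\<delta> > 0"
    "\<And>s. s > - \<delta> \<Longrightarrow> (SOME \<psi>. ?P \<psi>) s = integral {s..} \<phi>"
    by blast
  have "T (\<lambda>t. (SOME \<psi>. ?P \<psi>) t - \<psi> t) = 0"
  proof (rule causal_apply_eq_0[OF assms(2)])
    show "test_function (\<lambda>t. (SOME \<psi>. ?P \<psi>) t - \<psi> t)"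
      using test_function_add[OF \<delta>(1) test_function_cmult[OF \<psi>(1)], of "- 1"] by simp
    show "min \<delta> \<epsilon> > 0"
      using \<delta>(2) \<psi>(2) by simp
    show "(SOME \<psi>. ?P \<psi>) t - \<psi> t = 0" if "t > - min \<delta> \<epsilon>" for t
      using \<delta>(3)[of t] \<psi>(3)[of t] that by auto
  qed
  then show ?thesis
    unfolding integral_from_0_def using dist_diff_test[OF assms(1) \<delta>(1) \<psi>(1)] by simp
qed

lemma integral_from_0_cutoff:
  assumes "is_distribution T" "causal T" "test_function \<phi>"
  shows "integral_from_0 T \<phi> = T (\<lambda>s. cutoff s * integral {s..} \<phi>)"
proof -
  obtain R where R: "vanishes_beyond R \<phi>" "R > 2"
    using assms(3) by (rule test_function_vanishes)
  show ?thesis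
    by (rule integral_from_0_eq[OF assms(1,2) test_function_cutoff_tail(1)[OF assms(3) R(1)], of 1])
       (use R(2) cutoff_eq_1 in auto)
qed

lemma test_function_integrable:
  assumes "test_function \<phi>" shows "\<phi> integrable_on {s..}" and "\<phi> integrable_on UNIV"
proof -
  obtain R where R: "vanishes_beyond R \<phi>" "R > \<bar>s\<bar>"
    using assms by (rule test_function_vanishes)
  have int: "\<phi> integrable_on {a..R}" for a
    by (intro integrable_continuous_real smooth_continuous_on[OF test_function_smooth[OF assms]])
  show "\<phi> integrable_on {s..}"
    by (rule integrable_spike_set[OF int[of s]])
       (use R in \<open>auto simp: vanishes_beyond_def intro!: empty_imp_negligible\<close>)
  show "\<phi> integrable_on UNIV"
    by (rule integrable_spike_set[OF int[of "- R"]])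
       (use R in \<open>auto simp: vanishes_beyond_def intro!: empty_imp_negligible\<close>)
qed

lemma tail_integral_bound:
  assumes "test_function \<phi>" "vanishes_beyond R \<phi>" "\<And>t. \<bar>\<phi> t\<bar> \<le> B" "s \<in> {-R..R}"
  shows "\<bar>integral {s..} \<phi>\<bar> \<le> 2 * R * B"
proof -
  have "integral {s..} \<phi> = integral {s..R} \<phi>"
    by (rule integral_spike_set) (use assms(2) in \<open>auto simp: vanishes_beyond_def intro!: empty_imp_negligible\<close>)
  also have "norm \<dots> \<le> B * (R - s)"
    by (rule integral_bound) (use assms in \<open>auto intro: smooth_continuous_on test_function_smooth\<close>)
  also have "B * (R - s) \<le> B * (2 * R)"
    using assms(4) order_trans[OF abs_ge_zero assms(3)] by (intro mult_left_mono) auto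
  finally show ?thesis
    by (simp add: mult.commute mult.left_commute)
qed

text \<open>
  With the cutoff, the running integral is \<open>T\<close> applied to a fixed linear expression in \<open>\<phi>\<close>.
  The function \<open>s \<mapsto> \<integral>\<^sub>s\<^sup>\<infinity> \<phi>\<close> is bounded on \<open>[-S, S]\<close> by \<open>2 S\<close> times a bound
  for \<open>\<phi>\<close>, and its higher derivatives are those of \<open>- \<phi>\<close>, so its derivatives are controlled by
  those of \<open>\<phi>\<close>; the product bound then handles the cutoff.\<close>
lemma is_distribution_integral_from_0:
  assumes "is_distribution T" "causal T" shows "is_distribution (integral_from_0 T)"
proof (rule is_distributionI)
  let ?tail = "\<lambda>\<phi> s. cutoff s * integral {s..} \<phi>"
  have test: "test_function (?tail \<phi>)" if \<phi>: "test_function \<phi>" for \<phi>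
  proof -
    obtain R where "vanishes_beyond R \<phi>" "R > 2"
      using \<phi> by (rule test_function_vanishes)
    then show ?thesis
      using test_function_cutoff_tail(1)[OF \<phi>] by simp
  qed
  note I = integral_from_0_cutoff[OF assms]
  {
    fix \<phi> \<psi> assume *: "test_function \<phi>" "test_function \<psi>"
    then show "integral_from_0 T (\<lambda>t. \<phi> t + \<psi> t) = integral_from_0 T \<phi> + integral_from_0 T \<psi>"
      using dist_add_test[OF assms(1) test[OF *(1)] test[OF *(2)]]
      by (simp add: I test_function_add test_function_integrable distrib_left integral_add)
  next
    fix c \<phi> assume *: "test_function \<phi>"
    then show "integral_from_0 T (\<lambda>t. c * \<phi> t) = c * integral_from_0 T \<phi>"
      using dist_cmult_test[OF assms(1) test[OF *], of c]
      by (simp add: I test_function_cmult mult.left_commute)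
  }
  fix R :: real
  \<comment> \<open>the cutoff may enlarge the support as far as \<open>-2\<close>\<close>
  define S where "S = max R 2"
  obtain C N where C: "C \<ge> 0" and CN: "\<And>\<phi> B. test_function \<phi> \<Longrightarrow> vanishes_beyond S \<phi> \<Longrightarrow>
      (\<And>k t. k \<le> N \<Longrightarrow> \<bar>(deriv ^^ k) \<phi> t\<bar> \<le> B) \<Longrightarrow> \<bar>T \<phi>\<bar> \<le> C * B"
    using is_distribution_bound[OF assms(1)] by blast
  obtain M where M: "\<And>f B k t. smooth f \<Longrightarrow>
      (\<And>j t. j \<le> N \<Longrightarrow> t \<in> {-S..S} \<Longrightarrow> \<bar>(deriv ^^ j) f t\<bar> \<le> B) \<Longrightarrow> B \<ge> 0 \<Longrightarrow>
      k \<le> N \<Longrightarrow> t \<in> {-S..S} \<Longrightarrow> \<bar>(deriv ^^ k) (\<lambda>t. cutoff t * f t) t\<bar> \<le> M * B"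
    using funpow_deriv_mult_bound_upto[OF smooth_cutoff] by blast
  have "\<bar>integral_from_0 T \<phi>\<bar> \<le> C * \<bar>M\<bar> * (2 * S + 1) * B"
    if \<phi>: "test_function \<phi>" "vanishes_beyond R \<phi>" and "B \<ge> 0"
      and B: "\<forall>k\<le>N. \<forall>t. \<bar>(deriv ^^ k) \<phi> t\<bar> \<le> B" for \<phi> B
  proof -
    have van: "vanishes_beyond S \<phi>"
      by (rule vanishes_beyond_mono[OF \<phi>(2)]) (simp add: S_def)
    have "S \<ge> 2" by (simp add: S_def)
    note tail = test_function_cutoff_tail[OF \<phi>(1) van \<open>S \<ge> 2\<close>]
    define B' where "B' = (2 * S + 1) * B"
    have B': "B' \<ge> B" "B' \<ge> 2 * S * B" "B' \<ge> 0"
      using \<open>S \<ge> 2\<close> \<open>B \<ge> 0\<close> by (auto simp: B'_def distrib_right)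
    have tail_bound: "\<bar>(deriv ^^ j) (\<lambda>s. integral {s..} \<phi>) t\<bar> \<le> B'"
      if "j \<le> N" "t \<in> {-S..S}" for j t
    proof (cases j)
      case 0
      have "\<bar>integral {t..} \<phi>\<bar> \<le> 2 * S * B"
        by (rule tail_integral_bound[OF \<phi>(1) van _ that(2)])
           (use B[rule_format, of 0] in simp)
      then show ?thesis
        using 0 B' by simp
    next
      case (Suc i)
      have "deriv (\<lambda>s. integral {s..} \<phi>) = (\<lambda>s. - 1 * \<phi> s)"
        using DERIV_imp_deriv[OF DERIV_tail_integral[OF \<phi>(1)]] by auto
      then have "(deriv ^^ j) (\<lambda>s. integral {s..} \<phi>) t = - (deriv ^^ i) \<phi> t"
        using funpow_deriv_cmult[OF test_function_smooth[OF \<phi>(1)], of i "- 1"]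
        by (simp add: Suc funpow_Suc_right del: funpow.simps)
      moreover have "\<bar>(deriv ^^ i) \<phi> t\<bar> \<le> B"
        using B that(1) Suc by simp
      ultimately show ?thesis
        using B' by simp
    qed
    have "\<bar>(deriv ^^ k) (?tail \<phi>) t\<bar> \<le> \<bar>M\<bar> * B'" if "k \<le> N" for k t
    proof (cases "t \<in> {-S..S}")
      case True
      have "\<bar>(deriv ^^ k) (?tail \<phi>) t\<bar> \<le> M * B'"
        by (rule M[OF smooth_tail_integral[OF \<phi>(1)] tail_bound B'(3) that True])
      also have "\<dots> \<le> \<bar>M\<bar> * B'"
        using B'(3) by (intro mult_right_mono) auto
      finally show ?thesis .
    next
      case False
      then have "(deriv ^^ k) (?tail \<phi>) t = 0"
        using vanishes_beyond_funpow_deriv[OF tail(2), of k] by (auto simp: vanishes_beyond_def)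
      then show ?thesis
        using B'(3) by simp
    qed
    then have "\<bar>T (?tail \<phi>)\<bar> \<le> C * (\<bar>M\<bar> * B')"
      by (rule CN[OF tail])
    then show ?thesis
      by (simp add: I \<phi>(1) B'_def mult.assoc)
  qed
  then show "\<exists>C N. \<forall>\<phi> B. test_function \<phi> \<longrightarrow> vanishes_beyond R \<phi> \<longrightarrow> B \<ge> 0 \<longrightarrow>
        (\<forall>k\<le>N. \<forall>t. \<bar>(deriv ^^ k) \<phi> t\<bar> \<le> B) \<longrightarrow> \<bar>integral_from_0 T \<phi>\<bar> \<le> C * B"
    by blast
qed

lemma causal_integral_from_0:
  assumes "is_distribution T" "causal T" shows "causal (integral_from_0 T)"
  unfolding causal_iff
proof (intro allI impI)
  fix \<phi> \<epsilon> assume \<phi>: "test_function \<phi>" "\<epsilon> > 0" "\<forall>t>-\<epsilon>. \<phi> t = (0::real)"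
  have "integral_from_0 T \<phi> = T (\<lambda>t. 0)"
  proof (rule integral_from_0_eq[OF assms test_function_zero \<phi>(2)])
    fix s assume "s > - \<epsilon>"
    then have "(\<phi> has_integral 0) {s..}"
      using \<phi>(3) by (intro has_integral_is_0) auto
    then show "0 = integral {s..} \<phi>"
      by (simp add: integral_unique)
  qed
  then show "integral_from_0 T \<phi> = 0"
    using dist_cmult_test[OF assms(1) test_function_zero, of 0] by simp
qed

lemma integral_from_0_deriv:
  assumes "is_distribution T" "causal T" "test_function \<phi>"
  shows "integral_from_0 T (deriv \<phi>) = - T \<phi>"
proof -
  have "integral_from_0 T (deriv \<phi>) = T (\<lambda>t. - 1 * \<phi> t)"
    by (rule integral_from_0_eq[OF assms(1,2) test_function_cmult[OF assms(3)] zero_less_one])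
       (simp add: tail_integral_deriv[OF assms(3)])
  then show ?thesis
    using dist_cmult_test[OF assms(1,3), of "- 1"] by simp
qed

section \<open>The equation and its homogeneous solutions\<close>

lemma integral_deriv_eq_0:
  assumes "test_function \<phi>" shows "integral UNIV (deriv \<phi>) = 0"
proof -
  obtain R where R: "vanishes_beyond R \<phi>" "R > 0"
    using assms by (rule test_function_vanishes)
  have "vanishes_beyond R (deriv \<phi>)"
    using vanishes_beyond_funpow_deriv[OF R(1), of 1] by simp
  then have "integral UNIV (deriv \<phi>) = integral {- R - 1..} (deriv \<phi>)"
    by (intro tail_integral_eq_UNIV[symmetric]) auto
  also have "\<dots> = 0"
    using R by (simp add: tail_integral_deriv[OF assms] vanishes_beyond_def)
  finally show ?thesis .
qed

text \<open>
  Subtracting the right multiple of the bump from \<open>\<phi>\<close> leaves a test function of integral zero.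
  Such a function is the derivative of a test function, so \<open>T\<close> annihilates it.\<close>
lemma zero_derivative_imp_constant:
  assumes "is_distribution T" and zero: "\<And>\<phi>. test_function \<phi> \<Longrightarrow> T (deriv \<phi>) = 0"
  shows "\<exists>c. \<forall>\<phi>. test_function \<phi> \<longrightarrow> T \<phi> = c * integral UNIV \<phi>"
proof (intro exI allI impI)
  fix \<phi> assume \<phi>: "test_function \<phi>"
  define k where "k = integral UNIV \<phi> / integral UNIV bump"
  define \<eta> where "\<eta> = (\<lambda>t. \<phi> t + - k * bump t)"
  note kb = test_function_cmult[OF test_function_bump, of "- k"]
  have \<eta>: "test_function \<eta>"
    unfolding \<eta>_def by (rule test_function_add[OF \<phi> kb])
  obtain R where R: "vanishes_beyond R \<eta>" "R > 0"
    using \<eta> by (rule test_function_vanishes)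
  have "integral UNIV \<eta> = integral UNIV \<phi> + - k * integral UNIV bump"
    unfolding \<eta>_def
    by (subst integral_add[OF test_function_integrable(2)[OF \<phi>] test_function_integrable(2)[OF kb]])
       (simp only: integral_mult_right)
  also have "\<dots> = 0"
    using bump_integral_pos by (simp add: k_def)
  finally have int0: "integral UNIV \<eta> = 0" .
  \<comment> \<open>As \<open>\<eta>\<close> has integral zero, its antiderivative vanishes on both sides of the support.\<close>
  define \<Psi> where "\<Psi> = (\<lambda>s. - 1 * integral {s..} \<eta>)"
  have "vanishes_beyond (R + 1) \<Psi>"
    unfolding vanishes_beyond_def
  proof (intro allI impI)
    fix s assume "R + 1 < \<bar>s\<bar>"
    then consider "s > R" | "s \<le> - R"
      using R(2) by linarith
    then show "\<Psi> s = 0"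
      using tail_integral_eq_0[OF R(1)] tail_integral_eq_UNIV[OF R(1)] int0
      by cases (simp_all add: \<Psi>_def)
  qed
  then have \<Psi>: "test_function \<Psi>"
    unfolding \<Psi>_def by (rule test_functionI[OF smooth_mult[OF smooth_const smooth_tail_integral[OF \<eta>]]])
  have "deriv \<Psi> = \<eta>"
  proof
    show "deriv \<Psi> s = \<eta> s" for s
      unfolding \<Psi>_def using DERIV_imp_deriv[OF DERIV_cmult[OF DERIV_tail_integral[OF \<eta>], of "- 1"]]
      by simp
  qed
  then have "0 = T \<eta>"
    using zero[OF \<Psi>] by simp
  also have "\<dots> = T \<phi> + - k * T bump"
    unfolding \<eta>_def by (simp only: dist_add_test[OF assms(1) \<phi> kb] dist_cmult_test[OF assms(1) test_function_bump])
  finally show "T \<phi> = (T bump / integral UNIV bump) * integral UNIV \<phi>"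
    by (simp add: k_def)
qed

lemma is_distribution_integral: "is_distribution (integral UNIV)"
proof (rule is_distributionI)
  show "integral UNIV (\<lambda>t. \<phi> t + \<psi> t) = integral UNIV \<phi> + integral UNIV \<psi>"
    if "test_function \<phi>" "test_function \<psi>" for \<phi> \<psi>
    using that by (simp add: integral_add test_function_integrable)
  show "integral UNIV (\<lambda>t. c * \<phi> t) = c * integral UNIV \<phi>" for c :: real and \<phi>
    by simp
  fix R :: real
  have "\<bar>integral UNIV \<phi>\<bar> \<le> 2 * \<bar>R\<bar> * B"
    if "test_function \<phi>" "vanishes_beyond R \<phi>" "\<forall>k\<le>0. \<forall>t. \<bar>(deriv ^^ k) \<phi> t\<bar> \<le> B" for \<phi> B
  proof -
    have van: "vanishes_beyond \<bar>R\<bar> \<phi>"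
      by (rule vanishes_beyond_mono[OF that(2)]) simp
    have "\<bar>integral {- \<bar>R\<bar>..} \<phi>\<bar> \<le> 2 * \<bar>R\<bar> * B"
      by (rule tail_integral_bound[OF that(1) van]) (use that(3) in auto)
    then show ?thesis
      using tail_integral_eq_UNIV[OF van, of "- \<bar>R\<bar>"] by simp
  qed
  then show "\<exists>C N. \<forall>\<phi> B. test_function \<phi> \<longrightarrow> vanishes_beyond R \<phi> \<longrightarrow> B \<ge> 0 \<longrightarrow>
        (\<forall>k\<le>N. \<forall>t. \<bar>(deriv ^^ k) \<phi> t\<bar> \<le> B) \<longrightarrow> \<bar>integral UNIV \<phi>\<bar> \<le> C * B"
    by blast
qed

text \<open>
  Seen as a smooth multiple of the constant distribution \<open>1\<close>, that is of integration, a smooth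
  function inherits everything known about multiples of distributions.\<close>
lemma regular_eq_fun_mult: "regular f = f *\<^sub>D integral UNIV"
  by (simp add: regular_def fun_mult_def)

lemma is_distribution_dist_add:
  assumes "is_distribution S" "is_distribution T" shows "is_distribution (S +\<^sub>D T)"
proof (rule is_distributionI)
  show "(S +\<^sub>D T) (\<lambda>t. \<phi> t + \<psi> t) = (S +\<^sub>D T) \<phi> + (S +\<^sub>D T) \<psi>"
    if "test_function \<phi>" "test_function \<psi>" for \<phi> \<psi>
    using that assms by (simp add: dist_add_def dist_add_test)
  show "(S +\<^sub>D T) (\<lambda>t. c * \<phi> t) = c * (S +\<^sub>D T) \<phi>" if "test_function \<phi>" for c \<phi>
    using that assms by (simp add: dist_add_def dist_cmult_test distrib_left)
  fix R :: real
  obtain C N where C: "C \<ge> 0" and CN: "\<And>\<phi> B. test_function \<phi> \<Longrightarrow> vanishes_beyond R \<phi> \<Longrightarrow>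
      (\<And>k t. k \<le> N \<Longrightarrow> \<bar>(deriv ^^ k) \<phi> t\<bar> \<le> B) \<Longrightarrow> \<bar>S \<phi>\<bar> \<le> C * B"
    using is_distribution_bound[OF assms(1)] by blast
  obtain C' N' where C': "C' \<ge> 0" and CN': "\<And>\<phi> B. test_function \<phi> \<Longrightarrow> vanishes_beyond R \<phi> \<Longrightarrow>
      (\<And>k t. k \<le> N' \<Longrightarrow> \<bar>(deriv ^^ k) \<phi> t\<bar> \<le> B) \<Longrightarrow> \<bar>T \<phi>\<bar> \<le> C' * B"
    using is_distribution_bound[OF assms(2)] by blast
  have "\<bar>(S +\<^sub>D T) \<phi>\<bar> \<le> (C + C') * B"
    if "test_function \<phi>" "vanishes_beyond R \<phi>"
      and B: "\<forall>k\<le>max N N'. \<forall>t. \<bar>(deriv ^^ k) \<phi> t\<bar> \<le> B" for \<phi> B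
  proof -
    have "\<bar>S \<phi>\<bar> \<le> C * B"
      by (rule CN[OF that(1,2)]) (use B in simp)
    moreover have "\<bar>T \<phi>\<bar> \<le> C' * B"
      by (rule CN'[OF that(1,2)]) (use B in simp)
    ultimately show ?thesis
      by (simp add: dist_add_def distrib_right)
  qed
  then show "\<exists>C N. \<forall>\<phi> B. test_function \<phi> \<longrightarrow> vanishes_beyond R \<phi> \<longrightarrow> B \<ge> 0 \<longrightarrow>
        (\<forall>k\<le>N. \<forall>t. \<bar>(deriv ^^ k) \<phi> t\<bar> \<le> B) \<longrightarrow> \<bar>(S +\<^sub>D T) \<phi>\<bar> \<le> C * B"
    by blast
qed

lemma smooth_cmult_exp: "smooth (\<lambda>t. c * exp (a * t))"
  by (rule smooth_mult[OF smooth_const smooth_exp])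

text \<open>
  The product rule for distributions, with an exponential factor.  It serves three purposes: to
  turn the homogeneous equation into \<open>z' = 0\<close>, to differentiate the exponential function as a
  distribution, and to differentiate the evoked solution.\<close>
lemma exp_mult_dist_deriv:
  assumes "is_distribution T" "test_function \<phi>"
  shows "((\<lambda>t. c * exp (a * t)) *\<^sub>D T) (deriv \<phi>)
      = T (deriv (\<lambda>t. c * exp (a * t) * \<phi> t)) - a * ((\<lambda>t. c * exp (a * t)) *\<^sub>D T) \<phi>"
proof -
  let ?g = "\<lambda>t. c * exp (a * t)"
  have g: "(?g has_real_derivative a * ?g t) (at t)" for t
    by (auto intro!: derivative_eq_intros)
  have "deriv (\<lambda>t. ?g t * \<phi> t) = (\<lambda>t. ?g t * deriv \<phi> t + a * (?g t * \<phi> t))"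
  proof
    show "deriv (\<lambda>t. ?g t * \<phi> t) t = ?g t * deriv \<phi> t + a * (?g t * \<phi> t)" for t
      using DERIV_imp_deriv[OF DERIV_mult[OF g smooth_DERIV[OF test_function_smooth[OF assms(2)]]], of t]
      by (simp add: algebra_simps)
  qed
  then have "T (deriv (\<lambda>t. ?g t * \<phi> t)) = T (\<lambda>t. ?g t * deriv \<phi> t + a * (?g t * \<phi> t))"
    by (simp only:)
  also have "\<dots> = T (\<lambda>t. ?g t * deriv \<phi> t) + a * T (\<lambda>t. ?g t * \<phi> t)"
    using dist_add_test[OF assms(1) test_function_mult[OF smooth_cmult_exp test_function_deriv[OF assms(2)]]
        test_function_cmult[OF test_function_mult[OF smooth_cmult_exp assms(2)]]]
      dist_cmult_test[OF assms(1) test_function_mult[OF smooth_cmult_exp assms(2)]]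
    by simp
  finally show ?thesis
    by (simp add: fun_mult_apply)
qed

lemma first_order_operator_apply:
  assumes "is_distribution y" "test_function \<phi>"
  shows "((\<lambda>_. a\<^sub>0) *\<^sub>D y +\<^sub>D (\<lambda>_. a\<^sub>1) *\<^sub>D dist_deriv y) \<phi> = a\<^sub>0 * y \<phi> - a\<^sub>1 * y (deriv \<phi>)"
proof -
  have "deriv (\<lambda>t. a\<^sub>1 * \<phi> t) = (\<lambda>t. a\<^sub>1 * deriv \<phi> t)"
    using funpow_deriv_cmult[OF test_function_smooth[OF assms(2)], of 1] by simp
  then show ?thesis
    using dist_cmult_test[OF assms] dist_cmult_test[OF assms(1) test_function_deriv[OF assms(2)]]
    by (simp add: dist_add_def fun_mult_def dist_deriv_def)
qed

lemma total_solution_iff: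
  assumes "is_distribution x"
  shows "total_solution a\<^sub>0 a\<^sub>1 b\<^sub>0 x y \<longleftrightarrow> is_distribution y \<and>
      (\<forall>\<phi>. test_function \<phi> \<longrightarrow> a\<^sub>0 * y \<phi> - a\<^sub>1 * y (deriv \<phi>) = b\<^sub>0 * x \<phi>)"
  unfolding total_solution_def dist_eq_def
  by (rule conj_cong[OF refl])
     (simp add: first_order_operator_apply fun_mult_apply[of "\<lambda>_. b\<^sub>0"] dist_cmult_test[OF assms])

lemma spontaneous_solution_iff_test:
  "spontaneous_solution a\<^sub>0 a\<^sub>1 y \<longleftrightarrow> is_distribution y \<and>
      (\<forall>\<phi>. test_function \<phi> \<longrightarrow> a\<^sub>0 * y \<phi> - a\<^sub>1 * y (deriv \<phi>) = 0)"
  unfolding spontaneous_solution_def dist_eq_def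
  by (rule conj_cong[OF refl]) (simp add: first_order_operator_apply)

text \<open>
  The integrating factor \<open>exp (\<alpha> t)\<close> turns the homogeneous equation into \<open>z' = 0\<close>.\<close>
lemma spontaneous_solution_iff:
  assumes "a\<^sub>1 \<noteq> 0" and \<alpha>: "\<alpha> = a\<^sub>0 / a\<^sub>1"
  shows "spontaneous_solution a\<^sub>0 a\<^sub>1 y \<longleftrightarrow> (\<exists>c. y =\<^sub>D regular (\<lambda>t. c * exp (- \<alpha> * t)))"
proof
  assume "spontaneous_solution a\<^sub>0 a\<^sub>1 y"
  then have y: "is_distribution y"
    and eq: "\<And>\<phi>. test_function \<phi> \<Longrightarrow> a\<^sub>0 * y \<phi> - a\<^sub>1 * y (deriv \<phi>) = 0"
    by (auto simp: spontaneous_solution_iff_test)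
  let ?z = "(\<lambda>t. 1 * exp (\<alpha> * t)) *\<^sub>D y"
  have "?z (deriv \<phi>) = 0" if "test_function \<phi>" for \<phi>
  proof -
    have "\<alpha> * y (\<lambda>t. 1 * exp (\<alpha> * t) * \<phi> t) = y (deriv (\<lambda>t. 1 * exp (\<alpha> * t) * \<phi> t))"
    proof (rule mult_left_cancel[THEN iffD1, OF assms(1)])
      show "a\<^sub>1 * (\<alpha> * y (\<lambda>t. 1 * exp (\<alpha> * t) * \<phi> t)) = a\<^sub>1 * y (deriv (\<lambda>t. 1 * exp (\<alpha> * t) * \<phi> t))"
        using eq[OF test_function_mult[OF smooth_cmult_exp that], of 1 \<alpha>] assms(1)
        by (simp add: \<alpha>)
    qed
    then show ?thesis
      unfolding exp_mult_dist_deriv[OF y that] by (simp add: fun_mult_apply)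
  qed
  then obtain c where c: "\<And>\<phi>. test_function \<phi> \<Longrightarrow> ?z \<phi> = c * integral UNIV \<phi>"
    using zero_derivative_imp_constant[OF is_distribution_fun_mult[OF smooth_cmult_exp y], of 1 \<alpha>] by blast
  have "y \<phi> = regular (\<lambda>t. c * exp (- \<alpha> * t)) \<phi>" if "test_function \<phi>" for \<phi>
  proof -
    have "y \<phi> = ?z (\<lambda>t. exp (- \<alpha> * t) * \<phi> t)"
      by (simp add: fun_mult_apply mult.assoc[symmetric] flip: exp_add)
    also have "\<dots> = c * integral UNIV (\<lambda>t. exp (- \<alpha> * t) * \<phi> t)"
      by (rule c[OF test_function_mult[OF smooth_exp that]])
    finally show ?thesis
      by (simp add: regular_def mult.assoc)
  qed
  then show "\<exists>c. y =\<^sub>D regular (\<lambda>t. c * exp (- \<alpha> * t))"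
    unfolding dist_eq_def by blast
next
  assume "\<exists>c. y =\<^sub>D regular (\<lambda>t. c * exp (- \<alpha> * t))"
  then obtain c where c: "y =\<^sub>D (\<lambda>t. c * exp (- \<alpha> * t)) *\<^sub>D integral UNIV"
    unfolding regular_eq_fun_mult by blast
  have "is_distribution y"
    by (rule is_distribution_cong[OF is_distribution_fun_mult[OF smooth_cmult_exp is_distribution_integral] c])
  moreover have "a\<^sub>0 * y \<phi> - a\<^sub>1 * y (deriv \<phi>) = 0" if "test_function \<phi>" for \<phi>
  proof -
    have "y (deriv \<phi>) = \<alpha> * y \<phi>"
      using c that test_function_deriv[OF that] exp_mult_dist_deriv[OF is_distribution_integral that, of c "- \<alpha>"]
        integral_deriv_eq_0[OF test_function_mult[OF smooth_cmult_exp that], of c "- \<alpha>"]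
      by (simp add: dist_eq_def)
    then show ?thesis
      using assms by simp
  qed
  ultimately show "spontaneous_solution a\<^sub>0 a\<^sub>1 y"
    by (simp add: spontaneous_solution_iff_test)
qed

section \<open>Locally integrable excitations\<close>

text \<open>
  Integration by parts for an indefinite integral \<open>F\<close> of a merely integrable \<open>q\<close>, where \<open>F' = q\<close>
  need not hold everywhere.  Let \<open>H t\<close> be the defect of the formula on \<open>[a, t]\<close> and \<open>A\<close> the
  indefinite integral of \<open>\<bar>q\<bar>\<close>.  Then \<open>\<bar>H t - H s\<bar> \<le> 2 L (t - s) (A t - A s)\<close>, and since \<open>A\<close> is
  continuous, \<open>H\<close> has derivative zero at every point, hence is constant.\<close>
lemma integration_by_parts_indefinite:
  fixes q \<Phi> \<phi> :: "real \<Rightarrow> real"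
  assumes q: "q absolutely_integrable_on {a..b}" and "a \<le> b"
    and \<Phi>: "\<And>t. (\<Phi> has_real_derivative \<phi> t) (at t)" and \<phi>: "continuous_on UNIV \<phi>"
  shows "integral {a..b} (\<lambda>t. q t * \<Phi> t)
      = integral {a..b} q * \<Phi> b - integral {a..b} (\<lambda>t. integral {a..t} q * \<phi> t)"
proof -
  define F where "F = (\<lambda>t. integral {a..t} q)"
  define A where "A = (\<lambda>t. integral {a..t} (\<lambda>\<tau>. \<bar>q \<tau>\<bar>))"
  define H where "H = (\<lambda>t. integral {a..t} (\<lambda>\<tau>. q \<tau> * \<Phi> \<tau>) - F t * \<Phi> t + integral {a..t} (\<lambda>\<tau>. F \<tau> * \<phi> \<tau>))"
  have cont_\<Phi>: "continuous_on S \<Phi>" for S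
    using DERIV_isCont[OF \<Phi>] by (rule continuous_at_imp_continuous_on[OF ballI])
  have cont_\<phi>: "continuous_on S \<phi>" for S
    by (rule continuous_on_subset[OF \<phi>]) simp
  have int_q: "q integrable_on {a..b}" and int_abs: "(\<lambda>\<tau>. \<bar>q \<tau>\<bar>) integrable_on {a..b}"
    using q by (auto simp: absolutely_integrable_on_def)
  have cont_F: "continuous_on {a..b} F" and cont_A: "continuous_on {a..b} A"
    unfolding F_def A_def by (rule indefinite_integral_continuous_1; fact)+
  have "(\<lambda>\<tau>. \<Phi> \<tau> * q \<tau>) absolutely_integrable_on {a..b}"
    by (rule absolutely_integrable_bounded_measurable_product_real[OF _ _ _ q])
       (auto intro!: continuous_imp_measurable_on_sets_lebesgue cont_\<Phi> compact_imp_bounded compact_continuous_image)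
  then have int_q\<Phi>: "(\<lambda>\<tau>. q \<tau> * \<Phi> \<tau>) integrable_on {a..b}"
    by (simp add: absolutely_integrable_on_def mult.commute)
  have int_F\<phi>: "(\<lambda>\<tau>. F \<tau> * \<phi> \<tau>) integrable_on {a..b}"
    by (intro integrable_continuous_real continuous_on_mult cont_F cont_\<phi>)
  have "bounded (\<phi> ` {a..b})"
    by (intro compact_imp_bounded compact_continuous_image cont_\<phi> compact_Icc)
  then obtain L where L: "L > 0" "\<And>t. t \<in> {a..b} \<Longrightarrow> \<bar>\<phi> t\<bar> \<le> L"
    unfolding bounded_pos by auto
  have diff: "integral {a..t} h - integral {a..s} h = integral {s..t} h"
    if "h integrable_on {a..b}" "a \<le> s" "s \<le> t" "t \<le> b" for h :: "real \<Rightarrow> real" and s t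
    using Henstock_Kurzweil_Integration.integral_combine[of a s t h] integrable_subinterval_real[OF that(1), of a t] that by simp
  have incr: "\<bar>H t - H s\<bar> \<le> (t - s) * (2 * L * (A t - A s))"
    if st: "a \<le> s" "s \<le> t" "t \<le> b" for s t
  proof -
    have sub: "{s..t} \<subseteq> {a..b}" using st by auto
    note on_st = integrable_subinterval_real[OF _ sub]
    have A_diff: "integral {s..t} (\<lambda>\<tau>. \<bar>q \<tau>\<bar>) = A t - A s"
      unfolding A_def by (rule diff[OF int_abs st, symmetric])
    have i1: "(\<lambda>\<tau>. q \<tau> * \<Phi> \<tau> - q \<tau> * \<Phi> t) integrable_on {s..t}"
      by (intro integrable_diff integrable_on_mult_left on_st int_q int_q\<Phi>)
    have i\<phi>: "(\<phi> has_integral \<Phi> t - \<Phi> s) {s..t}"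
      by (rule fundamental_theorem_of_calculus[OF st(2)])
         (simp add: has_field_derivative_at_within[OF \<Phi>] flip: has_real_derivative_iff_has_vector_derivative)
    have i2: "(\<lambda>\<tau>. F \<tau> * \<phi> \<tau> - F s * \<phi> \<tau>) integrable_on {s..t}"
      by (intro integrable_diff integrable_on_mult_right on_st int_F\<phi> has_integral_integrable[OF i\<phi>])
    \<comment> \<open>Freezing \<open>\<Phi>\<close> at \<open>t\<close> and \<open>F\<close> at \<open>s\<close> makes the formula exact on \<open>[s, t]\<close>; only the
      deviations from the frozen values remain, and both are small.\<close>
    have "H t - H s = integral {s..t} (\<lambda>\<tau>. q \<tau> * \<Phi> \<tau>) - (F t * \<Phi> t - F s * \<Phi> s)
        + integral {s..t} (\<lambda>\<tau>. F \<tau> * \<phi> \<tau>)"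
      unfolding H_def using diff[OF int_q\<Phi> st] diff[OF int_F\<phi> st] by simp
    also have "F t * \<Phi> t - F s * \<Phi> s = (F t - F s) * \<Phi> t + F s * (\<Phi> t - \<Phi> s)"
      by (simp add: algebra_simps)
    also have "F t - F s = integral {s..t} q"
      unfolding F_def by (rule diff[OF int_q st])
    also have "\<Phi> t - \<Phi> s = integral {s..t} \<phi>"
      using i\<phi> by (simp add: integral_unique)
    also have "integral {s..t} (\<lambda>\<tau>. q \<tau> * \<Phi> \<tau>) - (integral {s..t} q * \<Phi> t + F s * integral {s..t} \<phi>)
        + integral {s..t} (\<lambda>\<tau>. F \<tau> * \<phi> \<tau>)
        = integral {s..t} (\<lambda>\<tau>. q \<tau> * \<Phi> \<tau> - q \<tau> * \<Phi> t) + integral {s..t} (\<lambda>\<tau>. F \<tau> * \<phi> \<tau> - F s * \<phi> \<tau>)"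
      by (subst (1 2) Henstock_Kurzweil_Integration.integral_diff)
         (auto intro!: on_st int_q\<Phi> int_F\<phi> int_q integrable_on_mult_left integrable_on_mult_right
            has_integral_integrable[OF i\<phi>])
    finally have split: "H t - H s = integral {s..t} (\<lambda>\<tau>. q \<tau> * \<Phi> \<tau> - q \<tau> * \<Phi> t)
        + integral {s..t} (\<lambda>\<tau>. F \<tau> * \<phi> \<tau> - F s * \<phi> \<tau>)" .
    have "\<bar>integral {s..t} (\<lambda>\<tau>. q \<tau> * \<Phi> \<tau> - q \<tau> * \<Phi> t)\<bar> \<le> integral {s..t} (\<lambda>\<tau>. \<bar>q \<tau>\<bar> * (L * (t - s)))"
    proof (subst real_norm_def[symmetric], rule Henstock_Kurzweil_Integration.integral_norm_bound_integral[OF i1])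
      show "(\<lambda>\<tau>. \<bar>q \<tau>\<bar> * (L * (t - s))) integrable_on {s..t}"
        by (intro integrable_on_mult_left on_st int_abs)
      fix \<tau> assume \<tau>: "\<tau> \<in> {s..t}"
      have "\<bar>\<Phi> \<tau> - \<Phi> t\<bar> \<le> L * \<bar>\<tau> - t\<bar>"
        unfolding real_norm_def[symmetric]
        by (rule field_differentiable_bound[of "{a..b}" _ \<phi>])
           (use L(2) \<tau> st has_field_derivative_at_within[OF \<Phi>] in simp_all)
      also have "\<dots> \<le> L * (t - s)"
        using \<tau> L(1) by (intro mult_left_mono) auto
      finally have "\<bar>q \<tau>\<bar> * \<bar>\<Phi> \<tau> - \<Phi> t\<bar> \<le> \<bar>q \<tau>\<bar> * (L * (t - s))"
        by (intro mult_left_mono) auto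
      then show "norm (q \<tau> * \<Phi> \<tau> - q \<tau> * \<Phi> t) \<le> \<bar>q \<tau>\<bar> * (L * (t - s))"
        by (simp add: abs_mult flip: right_diff_distrib)
    qed
    then have b1: "\<bar>integral {s..t} (\<lambda>\<tau>. q \<tau> * \<Phi> \<tau> - q \<tau> * \<Phi> t)\<bar> \<le> (A t - A s) * (L * (t - s))"
      by (simp add: A_diff)
    have b2: "\<bar>integral {s..t} (\<lambda>\<tau>. F \<tau> * \<phi> \<tau> - F s * \<phi> \<tau>)\<bar> \<le> ((A t - A s) * L) * (t - s)"
    proof (subst real_norm_def[symmetric], rule integral_bound[OF st(2)])
      show "continuous_on {s..t} (\<lambda>\<tau>. F \<tau> * \<phi> \<tau> - F s * \<phi> \<tau>)"
        by (intro continuous_intros continuous_on_subset[OF cont_F sub] cont_\<phi>)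
      fix \<tau> assume \<tau>: "\<tau> \<in> {s..t}"
      have s\<tau>: "a \<le> s" "s \<le> \<tau>" "\<tau> \<le> b" using \<tau> st by auto
      have "\<bar>F \<tau> - F s\<bar> = \<bar>integral {s..\<tau>} q\<bar>"
        unfolding F_def by (simp add: diff[OF int_q s\<tau>])
      also have "\<dots> \<le> integral {s..\<tau>} (\<lambda>\<tau>. \<bar>q \<tau>\<bar>)"
        using Henstock_Kurzweil_Integration.integral_norm_bound_integral[of q "{s..\<tau>}" "\<lambda>\<tau>. \<bar>q \<tau>\<bar>"] s\<tau>
          integrable_subinterval_real[OF int_q, of s \<tau>] integrable_subinterval_real[OF int_abs, of s \<tau>] by auto
      also have "\<dots> \<le> integral {s..t} (\<lambda>\<tau>. \<bar>q \<tau>\<bar>)"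
        using s\<tau> \<tau> integrable_subinterval_real[OF int_abs, of s \<tau>] on_st[OF int_abs]
        by (intro integral_subset_le) auto
      finally have "\<bar>F \<tau> - F s\<bar> \<le> A t - A s"
        by (simp add: A_diff)
      then have "\<bar>F \<tau> - F s\<bar> * \<bar>\<phi> \<tau>\<bar> \<le> (A t - A s) * L"
        using L \<tau> sub by (intro mult_mono) auto
      then show "norm (F \<tau> * \<phi> \<tau> - F s * \<phi> \<tau>) \<le> (A t - A s) * L"
        by (simp add: abs_mult flip: left_diff_distrib)
    qed
    show ?thesis
      unfolding split using b1 b2 by (simp add: algebra_simps)
  qed
  have "(H has_real_derivative 0) (at t within {a..b})" if t: "t \<in> {a..b}" for t
    unfolding has_field_derivative_iff
  proof (rule Lim_null_comparison)
    have "\<bar>(H s - H t) / (s - t)\<bar> \<le> 2 * L * \<bar>A s - A t\<bar>" if s: "s \<in> {a..b}" "s \<noteq> t" for s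
    proof (cases "s < t")
      case True
      then have "\<bar>H s - H t\<bar> \<le> \<bar>s - t\<bar> * (2 * L * (A t - A s))"
        using incr[of s t] s t by (simp add: abs_minus_commute)
      also have "\<dots> \<le> \<bar>s - t\<bar> * (2 * L * \<bar>A s - A t\<bar>)"
        using L(1) by (intro mult_left_mono) auto
      finally show ?thesis
        using s by (simp add: pos_divide_le_eq mult.commute)
    next
      case False
      then have "\<bar>H s - H t\<bar> \<le> \<bar>s - t\<bar> * (2 * L * (A s - A t))"
        using incr[of t s] s t by simp
      also have "\<dots> \<le> \<bar>s - t\<bar> * (2 * L * \<bar>A s - A t\<bar>)"
        using L(1) by (intro mult_left_mono) auto
      finally show ?thesis
        using s by (simp add: pos_divide_le_eq mult.commute)
    qed
    then show "\<forall>\<^sub>F s in at t within {a..b}. norm ((H s - H t) / (s - t)) \<le> 2 * L * \<bar>A s - A t\<bar>"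
      by (simp add: eventually_at_filter)
    have "(A \<longlongrightarrow> A t) (at t within {a..b})"
      using cont_A t by (simp add: continuous_on_def)
    then have "((\<lambda>s. 2 * L * \<bar>A s - A t\<bar>) \<longlongrightarrow> 2 * L * \<bar>A t - A t\<bar>) (at t within {a..b})"
      by (intro tendsto_intros)
    then show "((\<lambda>s. 2 * L * \<bar>A s - A t\<bar>) \<longlongrightarrow> 0) (at t within {a..b})"
      by simp
  qed
  then obtain c where c: "\<And>t. t \<in> {a..b} \<Longrightarrow> H t = c"
    using has_field_derivative_zero_constant[of "{a..b}" H] by auto
  have "H b = H a"
    using c \<open>a \<le> b\<close> by simp
  then show ?thesis
    unfolding H_def F_def by simp
qed

lemma causal_fun_eq_0: "causal_fun f \<Longrightarrow> t < 0 \<Longrightarrow> f t = 0"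
  unfolding causal_fun_def unit_step_def by (metis mult_zero_left)

lemma locally_integrable_mult:
  assumes "locally_integrable f" "continuous_on UNIV g"
  shows "locally_integrable (\<lambda>t. f t * g t)"
  unfolding locally_integrable_def
proof (intro allI)
  fix a b
  have g: "continuous_on {a..b} g"
    by (rule continuous_on_subset[OF assms(2)]) simp
  have "(\<lambda>t. g t * f t) absolutely_integrable_on {a..b}"
    by (rule absolutely_integrable_bounded_measurable_product_real)
       (use assms(1) g in \<open>auto simp: locally_integrable_def
          intro!: continuous_imp_measurable_on_sets_lebesgue compact_imp_bounded compact_continuous_image\<close>)
  then show "(\<lambda>t. f t * g t) absolutely_integrable_on {a..b}"
    by (simp add: mult.commute)
qed

lemma integrable_running_integral_test:
  assumes "locally_integrable q" "test_function \<phi>"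
  shows "(\<lambda>t. unit_step t * integral {0..t} q * \<phi> t) integrable_on UNIV"
proof -
  obtain R where R: "vanishes_beyond R \<phi>" "R > 0"
    using assms(2) by (rule test_function_vanishes)
  have "q integrable_on {0..R}"
    using assms(1) by (simp add: locally_integrable_def absolutely_integrable_on_def)
  then have "(\<lambda>t. integral {0..t} q * \<phi> t) integrable_on {0..R}"
    by (intro integrable_continuous_real continuous_on_mult
        smooth_continuous_on[OF test_function_smooth[OF assms(2)]])
       (rule indefinite_integral_continuous_1)
  then have "(\<lambda>t. unit_step t * integral {0..t} q * \<phi> t) integrable_on {0..R}"
    by (rule integrable_eq) (simp add: unit_step_def)
  then show ?thesis
    by (rule integrable_spike_set)
       (use R in \<open>auto simp: vanishes_beyond_def unit_step_def intro!: empty_imp_negligible\<close>)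
qed

text \<open>
  For a locally integrable function the distributional running integral is the ordinary one.
  Integration by parts moves the integration from the test function to \<open>q\<close>; the boundary term at
  \<open>R + 1\<close> vanishes because the test function does.\<close>
lemma integral_from_0_regular:
  assumes T: "is_distribution T" "causal T" "T =\<^sub>D regular q"
    and q: "locally_integrable q" "causal_fun q"
  shows "integral_from_0 T =\<^sub>D regular (\<lambda>t. unit_step t * integral {0..t} q)"
  unfolding dist_eq_def
proof (intro allI impI)
  fix \<phi> assume \<phi>: "test_function \<phi>"
  obtain R where R: "vanishes_beyond R \<phi>" "R > 2"
    using \<phi> by (rule test_function_vanishes)
  note tail = test_function_cutoff_tail[OF \<phi> R(1) less_imp_le[OF R(2)]]
  let ?Q = "\<lambda>t. integral {0..t} q" and ?\<Phi> = "\<lambda>s. integral {s..} \<phi>"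
  have "integral_from_0 T \<phi> = T (\<lambda>s. cutoff s * ?\<Phi> s)"
    by (rule integral_from_0_cutoff[OF T(1,2) \<phi>])
  also have "\<dots> = integral UNIV (\<lambda>s. q s * (cutoff s * ?\<Phi> s))"
    using T(3) tail(1) by (simp add: dist_eq_def regular_def)
  also have "\<dots> = integral {0..R + 1} (\<lambda>s. q s * (cutoff s * ?\<Phi> s))"
    by (rule integral_spike_set)
       (use causal_fun_eq_0[OF q(2)] tail_integral_eq_0[OF R(1)] in
         \<open>auto simp: not_le intro!: empty_imp_negligible\<close>)
  also have "\<dots> = integral {0..R + 1} (\<lambda>s. q s * ?\<Phi> s)"
    by (rule integral_cong) (simp add: cutoff_eq_1)
  also have "\<dots> = ?Q (R + 1) * ?\<Phi> (R + 1) - integral {0..R + 1} (\<lambda>t. ?Q t * - \<phi> t)"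
    by (rule integration_by_parts_indefinite[OF _ _ DERIV_tail_integral[OF \<phi>]])
       (use q(1) R(2) in \<open>auto simp: locally_integrable_def
          intro!: continuous_on_minus smooth_continuous_on[OF test_function_smooth[OF \<phi>]]\<close>)
  also have "\<dots> = integral {0..R + 1} (\<lambda>t. ?Q t * \<phi> t)"
    using tail_integral_eq_0[OF R(1), of "R + 1"] by simp
  also have "\<dots> = integral {0..R + 1} (\<lambda>t. unit_step t * ?Q t * \<phi> t)"
    by (rule integral_cong) (simp add: unit_step_def)
  also have "\<dots> = integral UNIV (\<lambda>t. unit_step t * ?Q t * \<phi> t)"
    by (rule integral_spike_set)
       (use R in \<open>auto simp: vanishes_beyond_def unit_step_def not_le intro!: empty_imp_negligible\<close>)
  finally show "integral_from_0 T \<phi> = regular (\<lambda>t. unit_step t * ?Q t) \<phi>"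
    by (simp add: regular_def)
qed

section \<open>Evoked and total solutions\<close>

text \<open>
  This is why the evoked solution is unique: no nonzero homogeneous solution is causal.\<close>
lemma causal_exponential_eq_0:
  assumes "causal (regular (\<lambda>t. c * exp (a * t)))"
  shows "c = 0"
proof -
  let ?\<phi> = "\<lambda>t. exp (- a * t) * bump t"
  have "regular (\<lambda>t. c * exp (a * t)) ?\<phi> = 0"
    by (rule causal_apply_eq_0[OF assms test_function_mult[OF smooth_exp test_function_bump] zero_less_one])
       (simp add: bump_def flat_exp_def)
  moreover have "(\<lambda>t. c * exp (a * t) * ?\<phi> t) = (\<lambda>t. c * bump t)"
    by (simp add: exp_minus fun_eq_iff)
  ultimately have "c * integral UNIV bump = 0"
    by (simp only: regular_def integral_mult_right)
  then show ?thesis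
    using bump_integral_pos by simp
qed

lemma dist_eq_refl: "T =\<^sub>D T"
  and dist_eq_sym: "S =\<^sub>D T \<Longrightarrow> T =\<^sub>D S"
  and dist_eq_trans: "S =\<^sub>D T \<Longrightarrow> T =\<^sub>D U \<Longrightarrow> S =\<^sub>D U"
  by (auto simp: dist_eq_def dist_add_def)

text \<open>
  Variation of constants.  With \<open>I\<close> the running integral of \<open>exp (\<alpha> \<tau>) x\<close>, the product rule gives
  \<open>y\<^sub>e' = - \<alpha> y\<^sub>e + \<beta> exp (- \<alpha> t) I'\<close>, and \<open>I' = exp (\<alpha> t) x\<close> cancels the exponential.\<close>
lemma causal_solution:
  fixes a\<^sub>0 a\<^sub>1 b\<^sub>0 \<alpha> \<beta> :: real
  assumes "a\<^sub>1 \<noteq> 0" "is_distribution x" "causal x"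
    and \<alpha>: "\<alpha> = a\<^sub>0 / a\<^sub>1" and \<beta>: "\<beta> = b\<^sub>0 / a\<^sub>1"
  defines "y\<^sub>e \<equiv> (\<lambda>t. \<beta> * exp (- \<alpha> * t)) *\<^sub>D integral_from_0 ((\<lambda>\<tau>. exp (\<alpha> * \<tau>)) *\<^sub>D x)"
  shows "total_solution a\<^sub>0 a\<^sub>1 b\<^sub>0 x y\<^sub>e" and "causal y\<^sub>e"
proof -
  define T where "T = (\<lambda>\<tau>. exp (\<alpha> * \<tau>)) *\<^sub>D x"
  have T: "is_distribution T" "causal T"
    unfolding T_def by (rule is_distribution_fun_mult[OF smooth_exp assms(2)],
        rule causal_fun_mult[OF smooth_exp assms(3)])
  note I = is_distribution_integral_from_0[OF T]
  show "causal y\<^sub>e"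
    unfolding y\<^sub>e_def T_def[symmetric] by (rule causal_fun_mult[OF smooth_cmult_exp causal_integral_from_0[OF T]])
  have "is_distribution y\<^sub>e"
    unfolding y\<^sub>e_def T_def[symmetric] by (rule is_distribution_fun_mult[OF smooth_cmult_exp I])
  moreover have "a\<^sub>0 * y\<^sub>e \<phi> - a\<^sub>1 * y\<^sub>e (deriv \<phi>) = b\<^sub>0 * x \<phi>" if \<phi>: "test_function \<phi>" for \<phi>
  proof -
    have g\<phi>: "test_function (\<lambda>t. \<beta> * exp (- \<alpha> * t) * \<phi> t)"
      by (rule test_function_mult[OF smooth_cmult_exp \<phi>])
    have "y\<^sub>e (deriv \<phi>) = - T (\<lambda>t. \<beta> * exp (- \<alpha> * t) * \<phi> t) - (- \<alpha>) * y\<^sub>e \<phi>"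
      unfolding y\<^sub>e_def T_def[symmetric] exp_mult_dist_deriv[OF I \<phi>] integral_from_0_deriv[OF T g\<phi>] ..
    also have "T (\<lambda>t. \<beta> * exp (- \<alpha> * t) * \<phi> t) = x (\<lambda>t. \<beta> * \<phi> t)"
    proof -
      have "(\<lambda>t. exp (\<alpha> * t) * (\<beta> * exp (- \<alpha> * t) * \<phi> t)) = (\<lambda>t. \<beta> * \<phi> t)"
        by (simp add: exp_minus fun_eq_iff)
      then show ?thesis
        by (simp only: T_def fun_mult_apply)
    qed
    also have "\<dots> = \<beta> * x \<phi>"
      by (rule dist_cmult_test[OF assms(2) \<phi>])
    finally show ?thesis
      using assms(1) by (simp add: \<alpha> \<beta> right_diff_distrib distrib_left)
  qed
  ultimately show "total_solution a\<^sub>0 a\<^sub>1 b\<^sub>0 x y\<^sub>e"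
    by (simp add: total_solution_iff[OF assms(2)])
qed

text \<open>Superposition, by linearity of the equation.\<close>
lemma total_solution_iff_particular:
  assumes x: "is_distribution x" and part: "total_solution a\<^sub>0 a\<^sub>1 b\<^sub>0 x y\<^sub>p"
  shows "total_solution a\<^sub>0 a\<^sub>1 b\<^sub>0 x y \<longleftrightarrow>
      (\<exists>y\<^sub>s. spontaneous_solution a\<^sub>0 a\<^sub>1 y\<^sub>s \<and> y =\<^sub>D y\<^sub>p +\<^sub>D y\<^sub>s)"
proof
  note p = part[unfolded total_solution_iff[OF x]]
  {
    assume "total_solution a\<^sub>0 a\<^sub>1 b\<^sub>0 x y"
    note y = this[unfolded total_solution_iff[OF x]]
    let ?z = "y +\<^sub>D (\<lambda>_. - 1) *\<^sub>D y\<^sub>p"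
    have z: "?z \<phi> = y \<phi> - y\<^sub>p \<phi>" if "test_function \<phi>" for \<phi>
      using dist_cmult_test[OF conjunct1[OF p] that, of "- 1"] by (simp add: dist_add_def fun_mult_apply)
    have "is_distribution ?z"
      using y p by (intro is_distribution_dist_add is_distribution_fun_mult smooth_const) auto
    moreover have "a\<^sub>0 * ?z \<phi> - a\<^sub>1 * ?z (deriv \<phi>) = 0" if "test_function \<phi>" for \<phi>
    proof -
      have "a\<^sub>0 * y \<phi> - a\<^sub>1 * y (deriv \<phi>) = a\<^sub>0 * y\<^sub>p \<phi> - a\<^sub>1 * y\<^sub>p (deriv \<phi>)"
        using y p that by simp
      then show ?thesis
        unfolding z[OF that] z[OF test_function_deriv[OF that]] by (simp add: right_diff_distrib)
    qed
    ultimately have "spontaneous_solution a\<^sub>0 a\<^sub>1 ?z"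
      by (simp add: spontaneous_solution_iff_test)
    moreover have "y =\<^sub>D y\<^sub>p +\<^sub>D ?z"
      unfolding dist_eq_def using z by (simp add: dist_add_def[of y\<^sub>p])
    ultimately show "\<exists>y\<^sub>s. spontaneous_solution a\<^sub>0 a\<^sub>1 y\<^sub>s \<and> y =\<^sub>D y\<^sub>p +\<^sub>D y\<^sub>s"
      by blast
  next
    assume "\<exists>y\<^sub>s. spontaneous_solution a\<^sub>0 a\<^sub>1 y\<^sub>s \<and> y =\<^sub>D y\<^sub>p +\<^sub>D y\<^sub>s"
    then obtain y\<^sub>s where "spontaneous_solution a\<^sub>0 a\<^sub>1 y\<^sub>s" and eq: "y =\<^sub>D y\<^sub>p +\<^sub>D y\<^sub>s"
      by blast
    note s = this(1)[unfolded spontaneous_solution_iff_test]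
    have "is_distribution y"
      by (rule is_distribution_cong[OF is_distribution_dist_add eq]) (use p s in auto)
    moreover have "a\<^sub>0 * y \<phi> - a\<^sub>1 * y (deriv \<phi>) = b\<^sub>0 * x \<phi>" if "test_function \<phi>" for \<phi>
    proof -
      have "y \<phi> = y\<^sub>p \<phi> + y\<^sub>s \<phi>" "y (deriv \<phi>) = y\<^sub>p (deriv \<phi>) + y\<^sub>s (deriv \<phi>)"
        using eq that test_function_deriv[OF that] by (simp_all add: dist_eq_def dist_add_def)
      moreover have "a\<^sub>0 * y\<^sub>p \<phi> - a\<^sub>1 * y\<^sub>p (deriv \<phi>) = b\<^sub>0 * x \<phi>" "a\<^sub>0 * y\<^sub>s \<phi> - a\<^sub>1 * y\<^sub>s (deriv \<phi>) = 0"
        using p s that by simp_all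
      ultimately show ?thesis
        by (simp add: distrib_left)
    qed
    ultimately show "total_solution a\<^sub>0 a\<^sub>1 b\<^sub>0 x y"
      by (simp add: total_solution_iff[OF x])
  }
qed

theorem mainTheorem5:
  fixes a\<^sub>0 a\<^sub>1 b\<^sub>0 \<alpha> \<beta> :: real and x y\<^sub>e :: functional and y\<^sub>s :: "real \<Rightarrow> functional"
  assumes "a\<^sub>1 \<noteq> 0"
    and "is_distribution x" and "causal x"
  defines "\<alpha> \<equiv> a\<^sub>0 / a\<^sub>1" and "\<beta> \<equiv> b\<^sub>0 / a\<^sub>1"
  defines "y\<^sub>e \<equiv> (\<lambda>t. \<beta> * exp (- \<alpha> * t)) *\<^sub>D integral_from_0 ((\<lambda>\<tau>. exp (\<alpha> * \<tau>)) *\<^sub>D x)"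
  defines "y\<^sub>s \<equiv> (\<lambda>c. regular (\<lambda>t. c * exp (- \<alpha> * t)))"
  shows "(\<forall>y. total_solution a\<^sub>0 a\<^sub>1 b\<^sub>0 x y \<longleftrightarrow> (\<exists>c. y =\<^sub>D y\<^sub>e +\<^sub>D y\<^sub>s c))
    \<and> (\<forall>y. evoked_solution a\<^sub>0 a\<^sub>1 b\<^sub>0 x y \<longleftrightarrow> y =\<^sub>D y\<^sub>e)
    \<and> (\<forall>y. spontaneous_solution a\<^sub>0 a\<^sub>1 y \<longleftrightarrow> (\<exists>c. y =\<^sub>D y\<^sub>s c))
    \<and> (\<forall>f. locally_integrable f \<longrightarrow> causal_fun f \<longrightarrow> x =\<^sub>D regular f \<longrightarrow>
         y\<^sub>e =\<^sub>D regular (\<lambda>t. unit_step t * \<beta> * exp (- \<alpha> * t) *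
                          integral {0..t} (\<lambda>\<tau>. f \<tau> * exp (\<alpha> * \<tau>))) \<and>
         (\<forall>y. total_solution a\<^sub>0 a\<^sub>1 b\<^sub>0 x y \<longleftrightarrow>
            (\<exists>c. y =\<^sub>D regular (\<lambda>t. unit_step t * \<beta> * exp (- \<alpha> * t) *
                                integral {0..t} (\<lambda>\<tau>. f \<tau> * exp (\<alpha> * \<tau>))
                              + c * exp (- \<alpha> * t)))))"
proof -
  have y\<^sub>e: "total_solution a\<^sub>0 a\<^sub>1 b\<^sub>0 x y\<^sub>e" "causal y\<^sub>e"
    unfolding y\<^sub>e_def using causal_solution[OF assms(1-3) \<alpha>_def[THEN meta_eq_to_obj_eq]
        \<beta>_def[THEN meta_eq_to_obj_eq]] by blast+
  have y\<^sub>e_dist: "is_distribution y\<^sub>e"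
    using y\<^sub>e(1) by (simp add: total_solution_def)
  have spont: "spontaneous_solution a\<^sub>0 a\<^sub>1 y \<longleftrightarrow> (\<exists>c. y =\<^sub>D y\<^sub>s c)" for y
    unfolding y\<^sub>s_def by (rule spontaneous_solution_iff[OF assms(1)]) (simp add: \<alpha>_def)
  have total: "total_solution a\<^sub>0 a\<^sub>1 b\<^sub>0 x y \<longleftrightarrow> (\<exists>c. y =\<^sub>D y\<^sub>e +\<^sub>D y\<^sub>s c)" for y
    unfolding total_solution_iff_particular[OF assms(2) y\<^sub>e(1)]
  proof
    assume "\<exists>z. spontaneous_solution a\<^sub>0 a\<^sub>1 z \<and> y =\<^sub>D y\<^sub>e +\<^sub>D z"
    then obtain z c where "y =\<^sub>D y\<^sub>e +\<^sub>D z" "z =\<^sub>D y\<^sub>s c"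
      using spont by blast
    then have "y =\<^sub>D y\<^sub>e +\<^sub>D y\<^sub>s c"
      by (simp add: dist_eq_def dist_add_def)
    then show "\<exists>c. y =\<^sub>D y\<^sub>e +\<^sub>D y\<^sub>s c" ..
  next
    assume "\<exists>c. y =\<^sub>D y\<^sub>e +\<^sub>D y\<^sub>s c"
    then obtain c where "y =\<^sub>D y\<^sub>e +\<^sub>D y\<^sub>s c" ..
    moreover have "spontaneous_solution a\<^sub>0 a\<^sub>1 (y\<^sub>s c)"
      using spont dist_eq_refl by blast
    ultimately show "\<exists>z. spontaneous_solution a\<^sub>0 a\<^sub>1 z \<and> y =\<^sub>D y\<^sub>e +\<^sub>D z"
      by blast
  qed
  have evoked: "evoked_solution a\<^sub>0 a\<^sub>1 b\<^sub>0 x y \<longleftrightarrow> y =\<^sub>D y\<^sub>e" for y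
  proof
    assume ev: "evoked_solution a\<^sub>0 a\<^sub>1 b\<^sub>0 x y"
    then have "causal y"
      by (simp add: evoked_solution_def)
    obtain z where z: "spontaneous_solution a\<^sub>0 a\<^sub>1 z" "y\<^sub>e =\<^sub>D y +\<^sub>D z"
      using ev y\<^sub>e(1) unfolding evoked_solution_def by blast
    then obtain c where c: "z =\<^sub>D y\<^sub>s c"
      using spont by blast
    have diff: "y\<^sub>s c \<phi> = y\<^sub>e \<phi> - y \<phi>" if "test_function \<phi>" for \<phi>
      using z(2) c that by (simp add: dist_eq_def dist_add_def)
    \<comment> \<open>a difference of two causal distributions\<close>
    have "causal (y\<^sub>s c)"
      using \<open>causal y\<close> y\<^sub>e(2) diff unfolding causal_def by simp
    then have "c = 0"
      unfolding y\<^sub>s_def by (rule causal_exponential_eq_0)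
    then have "y\<^sub>s c \<phi> = 0" for \<phi>
      by (simp add: y\<^sub>s_def regular_def)
    then show "y =\<^sub>D y\<^sub>e"
      using diff by (simp add: dist_eq_def)
  next
    assume eq: "y =\<^sub>D y\<^sub>e"
    then have "w =\<^sub>D y\<^sub>e +\<^sub>D z \<longleftrightarrow> w =\<^sub>D y +\<^sub>D z" for w z
      by (simp add: dist_eq_def dist_add_def)
    then show "evoked_solution a\<^sub>0 a\<^sub>1 b\<^sub>0 x y"
      unfolding evoked_solution_def
      using is_distribution_cong[OF y\<^sub>e_dist eq] causal_cong[OF y\<^sub>e(2) eq]
        total_solution_iff_particular[OF assms(2) y\<^sub>e(1)] by simp
  qed
  have regular_evoked:
    "y\<^sub>e =\<^sub>D regular (\<lambda>t. unit_step t * \<beta> * exp (- \<alpha> * t) * integral {0..t} (\<lambda>\<tau>. f \<tau> * exp (\<alpha> * \<tau>)))"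
      (is "_ =\<^sub>D regular ?W")
    and regular_total: "y\<^sub>e +\<^sub>D y\<^sub>s c =\<^sub>D regular (\<lambda>t. unit_step t * \<beta> * exp (- \<alpha> * t) *
        integral {0..t} (\<lambda>\<tau>. f \<tau> * exp (\<alpha> * \<tau>)) + c * exp (- \<alpha> * t))"
    if f: "locally_integrable f" "causal_fun f" "x =\<^sub>D regular f" for f c
  proof -
    let ?q = "\<lambda>\<tau>. f \<tau> * exp (\<alpha> * \<tau>)" and ?g = "\<lambda>t. \<beta> * exp (- \<alpha> * t)"
    define T where "T = (\<lambda>\<tau>. exp (\<alpha> * \<tau>)) *\<^sub>D x"
    have q: "locally_integrable ?q" "causal_fun ?q"
      by (rule locally_integrable_mult[OF f(1) smooth_continuous_on[OF smooth_exp]])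
         (use f(2) in \<open>auto simp: causal_fun_def\<close>)
    have "T \<phi> = regular ?q \<phi>" if "test_function \<phi>" for \<phi>
      using f(3) test_function_mult[OF smooth_exp that]
      by (simp add: T_def dist_eq_def regular_def fun_mult_apply mult.assoc)
    then have "T =\<^sub>D regular ?q"
      by (simp add: dist_eq_def)
    then have I: "integral_from_0 T =\<^sub>D regular (\<lambda>t. unit_step t * integral {0..t} ?q)"
      unfolding T_def by (rule integral_from_0_regular[OF is_distribution_fun_mult[OF smooth_exp assms(2)]
            causal_fun_mult[OF smooth_exp assms(3)] _ q])
    have W: "?W t * \<phi> t = unit_step t * integral {0..t} ?q * (?g t * \<phi> t)" for t and \<phi> :: "real \<Rightarrow> real"
      by (simp only: mult_ac)
    have y\<^sub>e_W: "y\<^sub>e \<phi> = regular ?W \<phi>" if "test_function \<phi>" for \<phi>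
      unfolding y\<^sub>e_def T_def[symmetric] fun_mult_apply regular_def W
      using I test_function_mult[OF smooth_cmult_exp that] by (simp only: dist_eq_def regular_def)
    show "y\<^sub>e =\<^sub>D regular ?W"
      using y\<^sub>e_W by (simp add: dist_eq_def)
    have "(y\<^sub>e +\<^sub>D y\<^sub>s c) \<phi> = regular (\<lambda>t. ?W t + c * exp (- \<alpha> * t)) \<phi>" if \<phi>: "test_function \<phi>" for \<phi>
    proof -
      have "(\<lambda>t. ?W t * \<phi> t) integrable_on UNIV"
        unfolding W by (rule integrable_running_integral_test[OF q(1) test_function_mult[OF smooth_cmult_exp \<phi>]])
      moreover have "(\<lambda>t. c * exp (- \<alpha> * t) * \<phi> t) integrable_on UNIV"
        by (rule test_function_integrable(2)[OF test_function_mult[OF smooth_cmult_exp \<phi>]])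
      ultimately show ?thesis
        unfolding dist_add_def y\<^sub>e_W[OF \<phi>] y\<^sub>s_def regular_def distrib_right
        by (rule Henstock_Kurzweil_Integration.integral_add[symmetric])
    qed
    then show "y\<^sub>e +\<^sub>D y\<^sub>s c =\<^sub>D regular (\<lambda>t. ?W t + c * exp (- \<alpha> * t))"
      by (simp add: dist_eq_def)
  qed
  show ?thesis
  proof (intro conjI allI impI)
    fix f y assume f: "locally_integrable f" "causal_fun f" "x =\<^sub>D regular f"
    have "y =\<^sub>D y\<^sub>e +\<^sub>D y\<^sub>s c \<longleftrightarrow> y =\<^sub>D regular (\<lambda>t. unit_step t * \<beta> * exp (- \<alpha> * t) *
        integral {0..t} (\<lambda>\<tau>. f \<tau> * exp (\<alpha> * \<tau>)) + c * exp (- \<alpha> * t))" for c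
      using regular_total[OF f, of c] by (meson dist_eq_sym dist_eq_trans)
    then show "total_solution a\<^sub>0 a\<^sub>1 b\<^sub>0 x y \<longleftrightarrow>
        (\<exists>c. y =\<^sub>D regular (\<lambda>t. unit_step t * \<beta> * exp (- \<alpha> * t) *
          integral {0..t} (\<lambda>\<tau>. f \<tau> * exp (\<alpha> * \<tau>)) + c * exp (- \<alpha> * t)))"
      using total by simp
  qed (use total evoked spont regular_evoked in \<open>blast+\<close>)
qed

end
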